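(* Let $d\in\mathbb{N}$ and let $p,q\in\mathcal{P}_d(\mathbb{R})$. (1) Every non-trivial root of $p\boxplus_d q$ is simple (has multiplicity one). (2) For every atom triplet $(\alpha,\beta,\alpha+\beta)$ of $(p,q,p\boxplus_d q)$, \[ \mu_{p\boxplus_d q}(\{\alpha+\beta\})=\mu_p(\{\alpha\})+\mu_q(\{\beta\})-1 \quad\text{and}\quad \mathcal{F}_{p\boxplus_d q}(\alpha+\beta)=\mathcal{F}_p(\alpha)+\mathcal{F}_q(\beta)-1 . \]
   Context: $\mathcal{P}_d(\mathbb{C})$ denotes the monic complex polynomials of degree $d$; for $K\subset\mathbb{C}$, $\mathcal{P}_d(K)$ is the set of those whose roots all lie in $K$. For $p(x)=\prod_{i=1}^d(x-\lambda_i)$ write $p(x)=\sum_{k=0}^d(-1)^k\binom{d}{k}\tilde e_k(p)x^{d-k}$, where $\tilde e_k(p)=\binom{d}{k}^{-1}\sum_{i_1<\dots<i_k}\lambda_{i_1}\cdots\lambda_{i_k}$, $\tilde e_0=1$. The finite free additive convolution $p\boxplus_d q$ is the polynomial with $\tilde e_k(p\boxplus_d q)=\sum_{i=0}^k\binom{k}{i}\tilde e_i(p)\tilde e_{k-i}(q)$ for $0\le k\le d$. The empirical root distribution is $\mu_p=\frac1d\sum_{i=1}^d\delta_{\lambda_i}$, and for real-rooted $p$, $\mathcal{F}_p(x)=\mu_p((-\infty,x])$ is its CDF. If $\alpha$ is a root of $p$ of multiplicity $m^p_\alpha$ and $\beta$ a root of $q$ of multiplicity $m^q_\beta$ with $m^p_\alpha+m^q_\beta-d>0$,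 then $\alpha+\beta$ is called a trivial root of $p\boxplus_d q$ and $(\alpha,\beta,\alpha+\beta)$ an atom triplet of $(p,q,p\boxplus_d q)$; roots of $p\boxplus_d q$ that are not trivial roots are called non-trivial. *)

theory Defs
  imports "HOL-Computational_Algebra.Polynomial" Complex_Main
begin

definition Pd :: "nat \<Rightarrow> complex set \<Rightarrow> complex poly set" where
  "Pd d K = {p. lead_coeff p = 1 \<and> degree p = d \<and> (\<forall>z. poly p z = 0 \<longrightarrow> z \<in> K)}"

text \<open>Normalized coefficients: p(x) = sum_k (-1)^k (d choose k) etilde_k(p) x^(d-k).\<close>
definition etilde :: "nat \<Rightarrow> complex poly \<Rightarrow> nat \<Rightarrow> complex" where
  "etilde d p k = (-1) ^ k * coeff p (d - k) / of_nat (d choose k)"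

definition ffconv :: "nat \<Rightarrow> complex poly \<Rightarrow> complex poly \<Rightarrow> complex poly" where
  "ffconv d p q = (\<Sum>k\<le>d. monom ((-1) ^ k * of_nat (d choose k) *
      (\<Sum>i\<le>k. of_nat (k choose i) * etilde d p i * etilde d q (k - i))) (d - k))"

definition root_measure :: "nat \<Rightarrow> complex poly \<Rightarrow> complex set \<Rightarrow> real" where
  "root_measure d p S = (\<Sum>r\<in>{r. poly p r = 0 \<and> r \<in> S}. real (order r p)) / real d"

definition root_cdf :: "nat \<Rightarrow> complex poly \<Rightarrow> real \<Rightarrow> real" where
  "root_cdf d p x = root_measure d p {z. z \<in> \<real> \<and> Re z \<le> x}"

definition atom_triplet :: "nat \<Rightarrow> complex poly \<Rightarrow> complex poly \<Rightarrow> complex \<Rightarrow> complex \<Rightarrow> bool" where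
  "atom_triplet d p q \<alpha> \<beta> \<longleftrightarrow> poly p \<alpha> = 0 \<and> poly q \<beta> = 0 \<and>
      int (order \<alpha> p) + int (order \<beta> q) - int d > 0"

definition trivial_root :: "nat \<Rightarrow> complex poly \<Rightarrow> complex poly \<Rightarrow> complex \<Rightarrow> bool" where
  "trivial_root d p q r \<longleftrightarrow> (\<exists>\<alpha> \<beta>. atom_triplet d p q \<alpha> \<beta> \<and> r = \<alpha> + \<beta>)"

end

theory Submission
  imports Defs "HOL-Computational_Algebra.Fundamental_Theorem_Algebra" "HOL-Analysis.Convex"
begin

text \<open>
  Expanding around any splitting \<open>y = s + t\<close>, the convolution is the apolarity pairing
  \<open>(p \<boxplus> q)(s + t) = (1/d!) \<Sum>\<^sub>k p\<^sup>(\<^sup>k\<^sup>)(s) q\<^sup>(\<^sup>d\<^sup>-\<^sup>k\<^sup>)(t)\<close>.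
  Splitting at an atom triplet gives the exact multiplicity of a trivial root. Splitting at a root of
  \<open>p\<close> peels it off and replaces \<open>q\<close> by a polar derivative, so that Laguerre's theorem yields Grace's
  theorem for half-planes. Hence \<open>F = ((x - \<nu>) u) \<boxplus> q\<close> is real-rooted, and it is interlaced by
  \<open>W = u \<boxplus> q'\<close>, its limit as \<open>\<nu>\<close> goes to infinity: \<open>W / F\<close> is a sum of simple fractions with positive residues.

  Sending the roots beyond a threshold to infinity one by one, interlacing gives the Weyl-type inequality
  \<open>#(p \<le> s) + #(q \<le> t) \<le> d + #(p \<boxplus> q \<le> s + t)\<close> and its mirror image. At an atom triplet
  the two inequalities and the multiplicity formula add up to equalities. The simplicity of the
  non-trivial roots follows by induction on the degree: interlacing forces \<open>W\<close> to vanish at a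
  multiple root of \<open>F\<close>, for every choice of the root \<open>\<nu>\<close> of \<open>p\<close>.
\<close>

section \<open>The bilinear form of the convolution\<close>

lemma sum_reverse_atMost:
  "(\<Sum>k\<le>(n::nat). f (n - k)) = (\<Sum>k\<le>n. f k)"
  by (rule sum.reindex_bij_witness[of _ "\<lambda>k. n - k" "\<lambda>k. n - k"]) auto

text \<open>Signs and binomials collapse to factorials, and \<open>fact j * coeff p j\<close> is the
  \<open>j\<close>-th derivative of \<open>p\<close> at 0; in this form the convolution is a pairing
  of derivatives.\<close>

lemma coeff_ffconv:
  assumes "n \<le> d"
  shows "coeff (ffconv d p q) (d - n) =
    (\<Sum>i\<le>n. fact (d - i) * fact (d - n + i) / (fact d * fact (d - n)) * coeff p (d - i) * coeff q (d - n + i))"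
proof -
  have "coeff (ffconv d p q) (d - n) =
      (\<Sum>k\<le>d. if k = n then (-1) ^ k * of_nat (d choose k) *
      (\<Sum>i\<le>k. of_nat (k choose i) * etilde d p i * etilde d q (k - i)) else 0)"
    unfolding ffconv_def coeff_sum using assms by (intro sum.cong) auto
  also have "\<dots> = (-1) ^ n * of_nat (d choose n) *
      (\<Sum>i\<le>n. of_nat (n choose i) * etilde d p i * etilde d q (n - i))"
    using assms by simp
  also have "\<dots> = (\<Sum>i\<le>n. fact (d - i) * fact (d - n + i) / (fact d * fact (d - n)) * coeff p (d - i) * coeff q (d - n + i))"
    unfolding sum_distrib_left
  proof (intro sum.cong refl)
    fix i assume "i \<in> {..n}"
    hence i: "i \<le> n" "i \<le> d" using assms by auto
    have eq: "d - (n - i) = d - n + i" using i assms by auto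
    have sgn: "(-1) ^ n * ((-1) ^ i * (-1) ^ (n - i)) = (1::complex)"
      using i by (simp flip: power_add power_mult_distrib)
    have c1: "of_nat (d choose n) = (fact d / (fact n * fact (d - n)) :: complex)"
      using assms by (rule binomial_fact)
    have c2: "of_nat (n choose i) = (fact n / (fact i * fact (n - i)) :: complex)"
      using i by (intro binomial_fact)
    have c3: "of_nat (d choose i) = (fact d / (fact i * fact (d - i)) :: complex)"
      using i by (intro binomial_fact)
    have c4: "of_nat (d choose (n - i)) = (fact d / (fact (n - i) * fact (d - n + i)) :: complex)"
      using i assms eq by (subst binomial_fact) auto
    have "(-1) ^ n * of_nat (d choose n) * (of_nat (n choose i) * etilde d p i * etilde d q (n - i))
       = ((-1) ^ n * ((-1) ^ i * (-1) ^ (n - i))) * (of_nat (d choose n) * of_nat (n choose i) / (of_nat (d choose i) * of_nat (d choose (n - i)))) * coeff p (d - i) * coeff q (d - n + i)"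
      unfolding etilde_def eq by (simp add: mult_ac)
    also have "of_nat (d choose n) * of_nat (n choose i) / (of_nat (d choose i) * of_nat (d choose (n - i))) = 
       (fact (d - i) * fact (d - n + i) / (fact d * fact (d - n)) :: complex)"
      unfolding c1 c2 c3 c4 by (simp add: field_simps)
    finally show "(-1) ^ n * of_nat (d choose n) * (of_nat (n choose i) * etilde d p i * etilde d q (n - i))
       = fact (d - i) * fact (d - n + i) / (fact d * fact (d - n)) * coeff p (d - i) * coeff q (d - n + i)"
      unfolding sgn by simp
  qed
  finally show ?thesis .
qed

lemma ffconv_commute: "ffconv d p q = ffconv d q p"
proof -
  have "(\<Sum>i\<le>k. of_nat (k choose i) * etilde d p i * etilde d q (k - i))
      = (\<Sum>i\<le>k. of_nat (k choose i) * etilde d q i * etilde d p (k - i))" for k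
    by (subst sum_reverse_atMost[symmetric])
       (auto intro!: sum.cong simp: binomial_symmetric[symmetric] mult_ac)
  thus ?thesis unfolding ffconv_def by simp
qed

lemma degree_ffconv_le: "degree (ffconv d p q) \<le> d"
  unfolding ffconv_def by (intro degree_sum_le) (auto intro: order.trans[OF degree_monom_le])

lemma etilde_add: "etilde d (p + q) k = etilde d p k + etilde d q k"
  by (simp add: etilde_def algebra_simps add_divide_distrib)

lemma etilde_smult: "etilde d (smult c p) k = c * etilde d p k"
  by (simp add: etilde_def)

lemma ffconv_add_left: "ffconv d (p + p') q = ffconv d p q + ffconv d p' q"
  unfolding ffconv_def
  by (simp add: etilde_add ring_distribs sum.distrib flip: add_monom)

lemma smult_sum_right: "smult c (sum f A) = (\<Sum>x\<in>A. smult c (f x))"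
  by (induction A rule: infinite_finite_induct) (simp_all add: smult_add_right)

lemma ffconv_smult_left: "ffconv d (smult c p) q = smult c (ffconv d p q)"
  unfolding ffconv_def smult_sum_right smult_monom etilde_smult
  by (intro sum.cong refl arg_cong2[where f = monom]) (simp add: sum_distrib_left mult_ac)

lemma ffconv_smult_right: "ffconv d p (smult c q) = smult c (ffconv d p q)"
  by (metis ffconv_commute ffconv_smult_left)

lemma ffconv_diff_left: "ffconv d (p - p') q = ffconv d p q - ffconv d p' q"
  using ffconv_add_left[of d p "smult (-1) p'" q] unfolding ffconv_smult_left by simp

lemma pderiv_sum: "pderiv (sum f A) = (\<Sum>x\<in>A. pderiv (f x))"
  using higher_pderiv_sum[of 1] by simp

lemma higher_pderiv_eq_0:
  fixes p :: "'a :: {comm_semiring_1,semiring_no_zero_divisors,semiring_char_0} poly"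
  assumes "degree p < k"
  shows "(pderiv ^^ k) p = 0"
proof -
  have "(pderiv ^^ degree p) p = [:coeff ((pderiv ^^ degree p) p) 0:]"
    using degree_higher_pderiv[of "degree p" p] by (auto elim: degree_eq_zeroE)
  hence "pderiv ((pderiv ^^ degree p) p) = 0" by (metis pderiv_singleton)
  hence "(pderiv ^^ (k - Suc (degree p))) ((pderiv ^^ Suc (degree p)) p) = 0" by simp
  moreover have "k - Suc (degree p) + Suc (degree p) = k" using assms by simp
  ultimately show ?thesis by (metis comp_apply funpow_add)
qed

lemma fact_mult_pochhammer: "fact j * pochhammer (of_nat (Suc j)) k = (fact (j + k) :: 'a :: {comm_semiring_1, semiring_char_0})"
  by (induction k) (simp_all add: pochhammer_Suc add_ac mult_ac flip: mult.assoc)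

text \<open>Convolution with \<open>q\<close> acts on \<open>p\<close> as a constant-coefficient
  differential operator whose coefficients are derivatives of \<open>q\<close> at 0, so it commutes
  with differentiation.\<close>

lemma ffconv_eq:
  assumes "degree p \<le> d"
  shows "ffconv d p q = (\<Sum>k\<le>d. smult (poly ((pderiv ^^ (d - k)) q) 0 / fact d) ((pderiv ^^ k) p))"
proof (rule poly_eqI)
  fix j
  show "coeff (ffconv d p q) j = coeff (\<Sum>k\<le>d. smult (poly ((pderiv ^^ (d - k)) q) 0 / fact d) ((pderiv ^^ k) p)) j"
  proof (cases "j \<le> d")
    case False
    have "coeff p (j + k) = 0" for k using assms False by (intro coeff_eq_0) auto
    thus ?thesis using False degree_ffconv_le[of d p q]
      by (simp add: coeff_sum coeff_higher_pderiv coeff_eq_0)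
  next
    case True
    define n where "n = d - j"
    have n: "n \<le> d" "j = d - n" using True by (auto simp: n_def)
    have "coeff (\<Sum>k\<le>d. smult (poly ((pderiv ^^ (d - k)) q) 0 / fact d) ((pderiv ^^ k) p)) j
      = (\<Sum>k\<le>d. fact (d - k) * coeff q (d - k) / fact d * (pochhammer (of_nat (Suc j)) k * coeff p (j + k)))"
      by (simp add: coeff_sum coeff_higher_pderiv poly_0_coeff_0 pochhammer_fact)
    also have "\<dots> = (\<Sum>k\<le>n. fact (d - k) * coeff q (d - k) / fact d * (pochhammer (of_nat (Suc j)) k * coeff p (j + k)))"
      using n assms by (intro sum.mono_neutral_right) (auto intro!: coeff_eq_0)
    also have "\<dots> = (\<Sum>k\<le>n. fact (d - k) * fact (d - n + k) / (fact d * fact (d - n)) * coeff q (d - k) * coeff p (d - n + k))"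
      unfolding n(2)[symmetric] by (intro sum.cong) (auto simp: fact_mult_pochhammer[symmetric] simp del: of_nat_Suc)
    also have "\<dots> = coeff (ffconv d q p) j" using coeff_ffconv[of n d q p] n by simp
    finally show ?thesis by (simp add: ffconv_commute)
  qed
qed

text \<open>For fixed \<open>s + t\<close> the pairing does not depend on the splitting: its
  derivative in \<open>t\<close> telescopes to terms containing derivatives of order
  \<open>Suc d\<close>. At \<open>t = 0\<close> it is \<open>ffconv_eq\<close>.\<close>

lemma poly_ffconv:
  assumes p: "degree p \<le> d" and q: "degree q \<le> d"
  shows "poly (ffconv d p q) (s + t) = (\<Sum>k\<le>d. poly ((pderiv ^^ k) p) s * poly ((pderiv ^^ (d - k)) q) t) / fact d"
proof -
  \<comment> \<open>\<open>poly (P k) x\<close> is the \<open>k\<close>-th derivative of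
    \<open>p\<close> at \<open>s + t - x\<close>, so \<open>G\<close> at \<open>x\<close> is the
    pairing for the splitting \<open>(s + t - x) + x\<close>.\<close>
  define P where "P k = pcompose ((pderiv ^^ k) p) [:s + t, -1:]" for k
  define Q where "Q k = (pderiv ^^ k) q" for k
  define G where "G = (\<Sum>k\<le>d. P k * Q (d - k))"
  have dP: "pderiv (P k) = - P (Suc k)" for k
    by (simp add: P_def pderiv_pcompose pderiv_pCons)
  have dQ: "pderiv (Q k) = Q (Suc k)" for k
    by (simp add: Q_def)
  have "pderiv G = (\<Sum>k\<le>d. P k * Q (Suc d - k) - P (Suc k) * Q (Suc d - Suc k))"
    unfolding G_def pderiv_sum
    by (intro sum.cong) (auto simp: pderiv_mult dP dQ Suc_diff_le)
  also have "\<dots> = P 0 * Q (Suc d) - P (Suc d) * Q 0"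
    by (subst sum_telescope) auto
  also have "\<dots> = 0"
    using p q by (simp add: P_def Q_def higher_pderiv_eq_0 del: funpow.simps)
  finally obtain h where "G = [:h:]" using pderiv_iszero by blast
  hence "poly G t = poly G 0" by simp
  thus ?thesis
    unfolding ffconv_eq[OF p] by (simp add: G_def P_def Q_def poly_sum poly_pcompose mult_ac flip: sum_divide_distrib)
qed

lemma pderiv_ffconv:
  assumes "degree p \<le> d"
  shows "pderiv (ffconv d p q) = ffconv d (pderiv p) q"
proof -
  have "degree (pderiv p) \<le> d" using assms by (simp add: degree_pderiv)
  thus ?thesis using assms by (simp add: ffconv_eq pderiv_sum pderiv_smult funpow_swap1)
qed

lemma higher_pderiv_ffconv:
  assumes "degree p \<le> d"
  shows "(pderiv ^^ j) (ffconv d p q) = ffconv d ((pderiv ^^ j) p) q"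
proof (induction j)
  case (Suc j)
  have "degree ((pderiv ^^ j) p) \<le> d" using assms by (simp add: degree_higher_pderiv)
  thus ?case using Suc by (simp add: pderiv_ffconv)
qed simp

text \<open>A factor of degree at most \<open>d\<close> has no derivative of order
  \<open>Suc d\<close>, so every remaining term differentiates \<open>q\<close> at least
  once.\<close>

lemma ffconv_Suc:
  assumes "degree u \<le> d" "degree q \<le> Suc d"
  shows "ffconv (Suc d) u q = ffconv d u (smult (1 / of_nat (Suc d)) (pderiv q))"
proof -
  have "ffconv (Suc d) u q = (\<Sum>k\<le>d. smult (poly ((pderiv ^^ (Suc d - k)) q) 0 / fact (Suc d)) ((pderiv ^^ k) u))"
    using assms by (simp add: ffconv_eq higher_pderiv_eq_0 del: funpow.simps fact_Suc)
  also have "\<dots> = smult (1 / of_nat (Suc d)) (ffconv d u (pderiv q))"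
    using assms unfolding ffconv_eq[OF assms(1)] smult_sum_right
    by (intro sum.cong) (auto simp: Suc_diff_le funpow_swap1)
  finally show ?thesis by (simp only: ffconv_smult_right)
qed

lemma lead_coeff_ffconv:
  assumes "p \<in> Pd d K" "q \<in> Pd d L"
  shows "coeff (ffconv d p q) d = 1"
  using coeff_ffconv[of 0 d p q] assms by (auto simp: Pd_def)

lemma degree_ffconv:
  assumes "p \<in> Pd d K" "q \<in> Pd d L"
  shows "degree (ffconv d p q) = d"
  using lead_coeff_ffconv[OF assms] degree_ffconv_le[of d p q] by (intro order.antisym le_degree) auto

section \<open>Multiplicity of the convolution at a sum of roots\<close>

lemma poly_higher_pderiv_less_order:
  fixes p :: "'a::{idom,semiring_char_0} poly"
  assumes "p \<noteq> 0" "i < order a p"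
  shows "poly ((pderiv ^^ i) p) a = 0"
  using assms
proof (induction i arbitrary: p)
  case 0
  thus ?case by (simp add: order_gt_0_iff)
next
  case (Suc i)
  hence "poly p a = 0" using order_0I by fastforce
  hence *: "order a p = Suc (order a (pderiv p))" using Suc.prems order_pderiv by blast
  show ?case
  proof (cases "pderiv p = 0")
    case False
    thus ?thesis using Suc * by (simp add: funpow_swap1)
  qed (simp add: funpow_swap1)
qed

lemma poly_higher_pderiv_order:
  fixes p :: "'a::{idom,semiring_char_0} poly"
  assumes "p \<noteq> 0"
  shows "poly ((pderiv ^^ order a p) p) a \<noteq> 0"
  using assms
proof (induction "order a p" arbitrary: p)
  case 0
  thus ?case by (metis funpow_0 order_root)
next
  case (Suc n)
  hence "poly p a = 0" using order_0I by fastforce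
  hence *: "order a p = Suc (order a (pderiv p))" using Suc.prems order_pderiv by blast
  have "pderiv p \<noteq> 0"
    using \<open>poly p a = 0\<close> Suc.prems by (metis pderiv_iszero poly_const_conv pCons_0_0)
  thus ?case using Suc.hyps * by (simp add: funpow_swap1)
qed

lemma order_eqI_higher_pderiv:
  fixes p :: "'a::{idom,semiring_char_0} poly"
  assumes "\<And>i. i < m \<Longrightarrow> poly ((pderiv ^^ i) p) a = 0" "poly ((pderiv ^^ m) p) a \<noteq> 0"
  shows "order a p = m"
proof -
  have "p \<noteq> 0" using assms(2) by auto
  thus ?thesis using assms poly_higher_pderiv_less_order poly_higher_pderiv_order
    by (metis linorder_neqE_nat)
qed

lemma PdD:
  assumes "p \<in> Pd d K"
  shows "degree p = d" "coeff p d = 1" "p \<noteq> 0" "poly p z = 0 \<Longrightarrow> z \<in> K"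
  using assms by (auto simp: Pd_def)

text \<open>In the \<open>j\<close>-th derivative, split at \<open>\<alpha>\<close> and
  \<open>\<beta>\<close>, a nonzero term needs \<open>m \<le> k + j\<close> and
  \<open>n \<le> d - k\<close>. This is impossible for \<open>j < m + n - d\<close>, and
  \<open>j = m + n - d\<close> leaves only \<open>k = d - n\<close>, whose term is nonzero.\<close>

lemma order_ffconv:
  assumes p: "p \<in> Pd d K" and q: "q \<in> Pd d L" and d: "d \<le> order \<alpha> p + order \<beta> q"
  shows "order (\<alpha> + \<beta>) (ffconv d p q) = order \<alpha> p + order \<beta> q - d"
proof -
  define m n where "m = order \<alpha> p" and "n = order \<beta> q"
  have [simp]: "p \<noteq> 0" "q \<noteq> 0" using p q by (auto simp: PdD)
  have "n \<le> d" using order_degree[of q \<beta>] q by (simp add: n_def PdD)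
  have eq: "poly ((pderiv ^^ j) (ffconv d p q)) (\<alpha> + \<beta>) =
      (\<Sum>k\<le>d. poly ((pderiv ^^ (k + j)) p) \<alpha> * poly ((pderiv ^^ (d - k)) q) \<beta>) / fact d" for j
    using p q by (simp add: PdD higher_pderiv_ffconv poly_ffconv degree_higher_pderiv funpow_add)
  have z: "poly ((pderiv ^^ (k + j)) p) \<alpha> * poly ((pderiv ^^ (d - k)) q) \<beta> = 0"
    if "k + j < m \<or> d - k < n" for j k
    using that poly_higher_pderiv_less_order[of p "k + j" \<alpha>] poly_higher_pderiv_less_order[of q "d - k" \<beta>]
    by (auto simp: m_def n_def)
  have "order (\<alpha> + \<beta>) (ffconv d p q) = m + n - d"
  proof (rule order_eqI_higher_pderiv)
    fix j assume "j < m + n - d"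
    hence "k + j < m \<or> d - k < n" if "k \<le> d" for k using that by linarith
    thus "poly ((pderiv ^^ j) (ffconv d p q)) (\<alpha> + \<beta>) = 0"
      unfolding eq by (subst sum.neutral) (use z in auto)
  next
    let ?j = "m + n - d"
    have other: "k + ?j < m \<or> d - k < n" if "k \<le> d" "k \<noteq> d - n" for k
      using that d \<open>n \<le> d\<close> unfolding m_def[symmetric] n_def[symmetric] by linarith
    have "(\<Sum>k\<le>d. poly ((pderiv ^^ (k + ?j)) p) \<alpha> * poly ((pderiv ^^ (d - k)) q) \<beta>)
       = (\<Sum>k\<in>{d - n}. poly ((pderiv ^^ (k + ?j)) p) \<alpha> * poly ((pderiv ^^ (d - k)) q) \<beta>)"
      using other z by (intro sum.mono_neutral_right) auto
    also have "\<dots> = poly ((pderiv ^^ m) p) \<alpha> * poly ((pderiv ^^ n) q) \<beta>"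
      using d \<open>n \<le> d\<close> by (simp add: m_def[symmetric] n_def[symmetric])
    finally show "poly ((pderiv ^^ ?j) (ffconv d p q)) (\<alpha> + \<beta>) \<noteq> 0"
      unfolding eq using poly_higher_pderiv_order[of p \<alpha>] poly_higher_pderiv_order[of q \<beta>]
      by (simp add: m_def n_def)
  qed
  thus ?thesis by (simp add: m_def n_def)
qed

section \<open>Polar derivatives and peeling off a root\<close>

lemma higher_pderiv_linear_mult:
  fixes u :: "'a::idom poly"
  shows "(pderiv ^^ k) ([:a, b:] * u) = [:a, b:] * (pderiv ^^ k) u + smult (of_nat k * b) ((pderiv ^^ (k - 1)) u)"
proof (induction k)
  case (Suc k)
  have 1: "pderiv ([:a, b:] * v) = [:a, b:] * pderiv v + smult b v" for v
    by (simp add: pderiv_mult pderiv_pCons pderiv_add pderiv_smult)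
  \<comment> \<open>At \<open>k = 0\<close> the truncated \<open>k - 1\<close> is harmless, as its
    coefficient is 0.\<close>
  show ?case
  proof (cases k)
    case (Suc l)
    have "(pderiv ^^ Suc k) ([:a, b:] * u) =
       [:a, b:] * (pderiv ^^ Suc k) u + (smult b ((pderiv ^^ k) u) + smult (of_nat k * b) ((pderiv ^^ k) u))"
      unfolding funpow.simps comp_apply Suc.IH pderiv_add 1 pderiv_smult using Suc
      by (simp only: funpow.simps comp_apply diff_Suc_1 add.assoc)
    thus ?thesis by (simp del: mult_pCons_left flip: smult_add_left add: algebra_simps)
  qed (simp add: 1 del: mult_pCons_left)
qed simp

text \<open>Laguerre's \<open>d q + (c - x) q'\<close>, divided by \<open>d\<close>.\<close>

definition polar_deriv :: "nat \<Rightarrow> complex \<Rightarrow> complex poly \<Rightarrow> complex poly" where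
  "polar_deriv d c q = q + smult (1 / of_nat d) ([:c, -1:] * pderiv q)"

lemma degree_polar_deriv:
  assumes "degree q \<le> Suc d"
  shows "degree (polar_deriv (Suc d) c q) \<le> d"
proof (rule degree_le, intro allI impI)
  fix i assume "d < i"
  then obtain j where j: "i = Suc j" "d \<le> j" by (cases i) auto
  show "coeff (polar_deriv (Suc d) c q) i = 0"
  proof (cases "j = d")
    case True
    have "coeff q (Suc (Suc d)) = 0" using assms by (intro coeff_eq_0) auto
    thus ?thesis using True j
      by (simp add: polar_deriv_def coeff_pderiv del: of_nat_Suc)
  next
    case False
    have "coeff q i = 0" "coeff q (Suc i) = 0" using assms False j by (auto intro!: coeff_eq_0)
    thus ?thesis using j by (simp add: polar_deriv_def coeff_pderiv)
  qed
qed

text \<open>Split at \<open>\<mu>\<close> and \<open>c\<close>: the \<open>k\<close>-th derivative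
  of \<open>(x - \<mu>) u\<close> at \<open>\<mu>\<close> is \<open>k\<close> times that of
  \<open>u\<close> of order \<open>k - 1\<close>, and the polar derivative of \<open>q\<close>
  absorbs this weight. The pole moves with the evaluation point, so the identity is
  pointwise.\<close>

lemma poly_ffconv_linear_mult:
  assumes u: "degree u \<le> d" and q: "degree q \<le> Suc d"
  shows "poly (ffconv (Suc d) ([:-\<mu>, 1:] * u) q) (\<mu> + c) = poly (ffconv d u (polar_deriv (Suc d) c q)) (\<mu> + c)"
proof -
  have deg: "degree ([:-\<mu>, 1:] * u) \<le> Suc d"
    using u degree_mult_le[of "[:-\<mu>, 1:]" u] by simp
  \<comment> \<open>At \<open>c\<close> the factor \<open>c - x\<close> vanishes, so only the second
    Leibniz term survives and the weight is \<open>1 - (d - k) / (d + 1)\<close>.\<close>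
  have q': "poly ((pderiv ^^ (d - k)) (polar_deriv (Suc d) c q)) c
      = of_nat (Suc k) / of_nat (Suc d) * poly ((pderiv ^^ (d - k)) q) c" if "k \<le> d" for k
  proof -
    have "poly ((pderiv ^^ (d - k)) (polar_deriv (Suc d) c q)) c
      = poly ((pderiv ^^ (d - k)) q) c - of_nat (d - k) / of_nat (Suc d) * poly ((pderiv ^^ (d - k)) q) c"
      unfolding polar_deriv_def higher_pderiv_add higher_pderiv_smult higher_pderiv_linear_mult
      by (cases "d - k") (simp_all add: funpow_swap1 divide_inverse algebra_simps)
    also have "\<dots> = (1 - of_nat (d - k) / of_nat (Suc d)) * poly ((pderiv ^^ (d - k)) q) c"
      by (simp only: left_diff_distrib mult_1_left)
    also have "1 - of_nat (d - k) / of_nat (Suc d) = (of_nat (Suc k) / of_nat (Suc d) :: complex)"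
      using that by (simp add: field_simps of_nat_diff del: of_nat_Suc) (simp add: algebra_simps)
    finally show ?thesis .
  qed
  have "poly (ffconv (Suc d) ([:-\<mu>, 1:] * u) q) (\<mu> + c) =
    (\<Sum>k\<le>Suc d. poly ((pderiv ^^ k) ([:-\<mu>, 1:] * u)) \<mu> * poly ((pderiv ^^ (Suc d - k)) q) c) / fact (Suc d)"
    using poly_ffconv[OF deg q] .
  also have "(\<Sum>k\<le>Suc d. poly ((pderiv ^^ k) ([:-\<mu>, 1:] * u)) \<mu> * poly ((pderiv ^^ (Suc d - k)) q) c)
     = (\<Sum>k\<le>d. of_nat (Suc k) * poly ((pderiv ^^ k) u) \<mu> * poly ((pderiv ^^ (d - k)) q) c)"
    unfolding higher_pderiv_linear_mult by (subst sum.atMost_Suc_shift) simp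
  also have "\<dots> / fact (Suc d) = (\<Sum>k\<le>d. poly ((pderiv ^^ k) u) \<mu> * (of_nat (Suc k) / of_nat (Suc d) * poly ((pderiv ^^ (d - k)) q) c)) / fact d"
    unfolding sum_divide_distrib by (intro sum.cong) (simp_all add: field_simps)
  also have "\<dots> = (\<Sum>k\<le>d. poly ((pderiv ^^ k) u) \<mu> * poly ((pderiv ^^ (d - k)) (polar_deriv (Suc d) c q)) c) / fact d"
    using q' by simp
  also have "\<dots> = poly (ffconv d u (polar_deriv (Suc d) c q)) (\<mu> + c)"
    using poly_ffconv[OF u degree_polar_deriv[OF q], of c \<mu> c] by simp
  finally show ?thesis .
qed

section \<open>Laguerre's and Grace's theorems for half-planes\<close>

lemma monic_complex_poly_factors:
  fixes q :: "complex poly"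
  assumes "q \<in> Pd d K"
  obtains r where "q = (\<Prod>i<d. [:- r i, 1:])" "\<And>i. i < d \<Longrightarrow> r i \<in> K"
proof -
  obtain r where r: "smult (lead_coeff q) (\<Prod>i<degree q. [:- r i, 1:]) = q"
    using complex_poly_decompose'[of q] by blast
  hence r': "q = (\<Prod>i<d. [:- r i, 1:])" using assms by (simp add: PdD)
  have "poly q (r i) = 0" if "i < d" for i unfolding r' poly_prod using that by auto
  thus ?thesis using that r' assms PdD by blast
qed

text \<open>Since \<open>(x - r i) + (c - x) = c - r i\<close>, the variable cancels in the product
  rule.\<close>

lemma smult_polar_deriv_prod:
  assumes "finite I" "card I = d" "d > 0"
  shows "smult (of_nat d) (polar_deriv d c (\<Prod>i\<in>I. [:- r i, 1:])) =
    (\<Sum>i\<in>I. smult (c - r i) (\<Prod>j\<in>I - {i}. [:- r j, 1:]))"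
proof -
  let ?q = "\<Prod>i\<in>I. [:- r i, 1:]" and ?u = "\<lambda>i. \<Prod>j\<in>I - {i}. [:- r j, 1:]"
  have "pderiv ?q = (\<Sum>i\<in>I. ?u i)"
    by (subst pderiv_prod) (simp add: pderiv_pCons)
  moreover have "smult (of_nat d) ?q = (\<Sum>i\<in>I. [:- r i, 1:] * ?u i)"
  proof -
    have "(\<Sum>i\<in>I. [:- r i, 1:] * ?u i) = (\<Sum>i\<in>I. ?q)"
      using assms by (intro sum.cong prod.remove[symmetric]) auto
    thus ?thesis using assms by (simp add: of_nat_poly)
  qed
  moreover have "[:- r i, 1:] * v + [:c, -1:] * v = smult (c - r i) v" for i v
    by (simp add: smult_diff_left)
  ultimately show ?thesis using assms
    by (simp add: polar_deriv_def smult_add_right sum_distrib_left del: mult_pCons_left flip: sum.distrib)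
qed

text \<open>Inversion at \<open>x\<close> turns the half-plane containing the roots into a disc, which contains the
  mean of the reciprocals \<open>1 / (x - r i)\<close>.\<close>
lemma polar_deriv_half_plane:
  assumes q: "q \<in> Pd (Suc d) {z. Re (\<omega> * z) \<le> b}" and c: "Re (\<omega> * c) > b"
  obtains \<kappa> where "\<kappa> \<noteq> 0" "smult \<kappa> (polar_deriv (Suc d) c q) \<in> Pd d {z. Re (\<omega> * z) \<le> b}"
proof -
  define A where "A = polar_deriv (Suc d) c q"
  obtain r where r: "q = (\<Prod>i<Suc d. [:- r i, 1:])" and rb: "\<And>i. i < Suc d \<Longrightarrow> Re (\<omega> * r i) \<le> b"
    using monic_complex_poly_factors[OF q] by auto
  let ?u = "\<lambda>i. \<Prod>j\<in>{..<Suc d} - {i}. [:- r j, 1:]"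
  have A: "smult (of_nat (Suc d)) A = (\<Sum>i<Suc d. smult (c - r i) (?u i))"
    unfolding A_def r by (rule smult_polar_deriv_prod) auto
  have cu: "coeff (?u i) d = 1" if "i < Suc d" for i
  proof -
    have "degree (?u i) = d" using that by (subst degree_prod_sum_eq) auto
    moreover have "lead_coeff (?u i) = 1" by (subst lead_coeff_prod) auto
    ultimately show ?thesis by simp
  qed
  have "of_nat (Suc d) * coeff A d = coeff (smult (of_nat (Suc d)) A) d" by simp
  also have "\<dots> = (\<Sum>i<Suc d. c - r i)"
    unfolding A coeff_sum by (intro sum.cong) (auto simp: cu simp del: prod.lessThan_Suc)
  finally have cA: "of_nat (Suc d) * coeff A d = (\<Sum>i<Suc d. c - r i)" .
  \<comment> \<open>The pole is strictly outside the half-plane, so all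
    \<open>\<omega> * (c - r i)\<close> have positive real part and the leading coefficient does not
    vanish.\<close>
  have "Re (\<omega> * (\<Sum>i<Suc d. c - r i)) = (\<Sum>i<Suc d. Re (\<omega> * c) - Re (\<omega> * r i))"
    by (simp only: sum_distrib_left right_diff_distrib Re_sum minus_complex.simps)
  also have "\<dots> > 0" using rb c by (intro sum_pos) fastforce+
  finally have "coeff A d \<noteq> 0" using cA by (metis mult_zero_right order_less_irrefl zero_complex.simps(1))
  moreover have dA: "degree A = d"
  proof (rule order.antisym)
    show "degree A \<le> d" unfolding A_def using q by (intro degree_polar_deriv) (simp add: PdD)
  qed (use \<open>coeff A d \<noteq> 0\<close> in \<open>rule le_degree\<close>)
  moreover have "Re (\<omega> * x) \<le> b" if x: "poly A x = 0" for x
  proof (rule ccontr)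
    assume "\<not> Re (\<omega> * x) \<le> b"
    define h where "h = Re (\<omega> * x) - b"
    have h: "h > 0" using \<open>\<not> Re (\<omega> * x) \<le> b\<close> by (simp add: h_def)
    define z where "z i = 1 / (x - r i)" for i
    define Z where "Z = (\<Sum>i<Suc d. z i)"
    define S where "S = (\<Sum>i<Suc d. (cmod (z i))\<^sup>2)"
    have nz: "x - r i \<noteq> 0" if "i < Suc d" for i using rb[OF that] \<open>\<not> Re (\<omega> * x) \<le> b\<close> by auto
    have qx: "poly q x \<noteq> 0" unfolding r poly_prod using nz by (simp del: prod.lessThan_Suc)
    have ux: "poly (?u i) x = poly q x * z i" if "i < Suc d" for i
      using that nz[OF that] unfolding r
      by (subst (2) prod.remove[of _ i]) (auto simp: z_def field_simps simp del: prod.lessThan_Suc)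
    \<comment> \<open>For a root \<open>x\<close> of \<open>A\<close> this yields
      \<open>(x - c) * Z = d + 1\<close>: the mean of the reciprocals \<open>z i\<close> is
      \<open>1 / (x - c)\<close>.\<close>
    have "0 = poly (smult (of_nat (Suc d)) A) x" using x by simp
    also have "\<dots> = (\<Sum>i<Suc d. (c - r i) * (poly q x * z i))"
      unfolding A poly_sum poly_smult by (intro sum.cong) (auto simp: ux simp del: prod.lessThan_Suc)
    also have "\<dots> = (\<Sum>i<Suc d. poly q x * (1 + (c - x) * z i))"
      using nz by (intro sum.cong) (auto simp: z_def field_simps)
    also have "\<dots> = poly q x * (of_nat (Suc d) + (c - x) * Z)"
      unfolding Z_def by (simp add: sum.distrib sum_distrib_left ring_distribs del: sum.lessThan_Suc)
    finally have "of_nat (Suc d) + (c - x) * Z = 0" using qx by auto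
    hence Z: "(x - c) * Z = of_nat (Suc d)" by (metis add_eq_0_iff minus_diff_eq minus_minus mult_minus_left)
    hence "Z \<noteq> 0" by (auto simp del: of_nat_Suc)
    \<comment> \<open>Inversion maps the half-plane at level \<open>h\<close> into this
      disc.\<close>
    have disc: "h * (cmod w)\<^sup>2 \<le> Re (\<omega> * cnj w)" if "w \<noteq> 0" "h \<le> Re (\<omega> / w)" for w
    proof -
      have "Re (\<omega> / w) = Re (\<omega> * cnj w) / (cmod w)\<^sup>2"
        by (subst complex_div_cnj) (simp only: Re_divide_of_real of_real_power[symmetric])
      hence "Re (\<omega> / w) * (cmod w)\<^sup>2 = Re (\<omega> * cnj w)" using that by simp
      thus ?thesis using mult_right_mono[OF that(2), of "(cmod w)\<^sup>2"] by simp
    qed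
    have "h * (cmod (z i))\<^sup>2 \<le> Re (\<omega> * cnj (z i))" if "i < Suc d" for i
      using rb[OF that] nz[OF that] by (intro disc) (auto simp: z_def h_def ring_distribs)
    hence "h * S \<le> Re (\<omega> * cnj Z)"
      unfolding S_def Z_def cnj_sum sum_distrib_left Re_sum by (intro sum_mono) auto
    \<comment> \<open>By Cauchy-Schwarz the mean of the \<open>z i\<close> stays in the
      disc.\<close>
    moreover have "(cmod Z)\<^sup>2 \<le> of_nat (Suc d) * S"
    proof -
      have "(cmod Z)\<^sup>2 \<le> (\<Sum>i<Suc d. cmod (z i))\<^sup>2"
        unfolding Z_def by (intro power_mono norm_sum) auto
      also have "\<dots> \<le> of_nat (Suc d) * S"
        using sum_squared_le_sum_of_squares[of "\<lambda>i. cmod (z i)" "{..<Suc d}"] by (simp add: S_def mult_ac)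
      finally show ?thesis .
    qed
    ultimately have "h * (cmod Z)\<^sup>2 \<le> of_nat (Suc d) * Re (\<omega> * cnj Z)"
      using h by (smt (verit) mult.left_commute mult_left_mono of_nat_0_le_iff)
    also have "\<dots> = Re (\<omega> * (x - c)) * (cmod Z)\<^sup>2"
    proof -
      have "of_real (of_nat (Suc d)) * (\<omega> * cnj Z) = (\<omega> * (x - c)) * of_real ((cmod Z)\<^sup>2)"
        using arg_cong[OF Z[symmetric], of "\<lambda>v. v * (\<omega> * cnj Z)"] by (simp add: complex_norm_square mult_ac del: of_real_power)
      hence "Re (of_real (of_nat (Suc d)) * (\<omega> * cnj Z)) = Re ((\<omega> * (x - c)) * of_real ((cmod Z)\<^sup>2))"
        by (rule arg_cong)
      thus ?thesis by (simp only: times_complex.simps Re_complex_of_real Im_complex_of_real mult_zero_left mult_zero_right diff_zero)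
    qed
    \<comment> \<open>Inverting back puts the pole \<open>c\<close> into the half-plane.\<close>
    finally have "h \<le> Re (\<omega> * (x - c))" using \<open>Z \<noteq> 0\<close> by simp
    thus False using c by (simp add: h_def ring_distribs)
  qed
  ultimately have "smult (1 / coeff A d) A \<in> Pd d {z. Re (\<omega> * z) \<le> b}"
    by (auto simp: Pd_def)
  thus ?thesis using that[of "1 / coeff A d"] \<open>coeff A d \<noteq> 0\<close> A_def by simp
qed

lemma Pd_Suc_factor:
  assumes "p \<in> Pd (Suc d) K" "poly p \<mu> = 0"
  obtains u where "p = [:-\<mu>, 1:] * u" "u \<in> Pd d K"
proof -
  obtain u where u: "p = [:-\<mu>, 1:] * u" using assms(2) by (auto simp: poly_eq_0_iff_dvd)
  have "u \<noteq> 0" using u PdD(3)[OF assms(1)] by auto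
  hence "degree p = Suc (degree u)" unfolding u by (subst degree_mult_eq) auto
  moreover have "lead_coeff p = lead_coeff u" unfolding u by (subst lead_coeff_mult) auto
  ultimately have "u \<in> Pd d K" using assms u by (auto simp: Pd_def)
  thus ?thesis using u that by blast
qed

lemma Pd_root_exists:
  assumes "p \<in> Pd (Suc d) K"
  obtains \<mu> where "poly p \<mu> = 0" "\<mu> \<in> K"
  using fundamental_theorem_of_algebra_alt[of p] assms PdD
  by (metis alg_closed_imp_poly_has_root nat.distinct(1) zero_less_Suc)

text \<open>Grace's theorem. For a zero \<open>y\<close> beyond level \<open>a + b\<close>, the pole
  \<open>y - \<mu>\<close> is beyond level \<open>b\<close>; Laguerre's theorem then keeps the roots
  of the polar derivative of \<open>q\<close> in its half-plane, and \<open>y\<close> remains a zero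
  after \<open>\<mu>\<close> is peeled off.\<close>

lemma ffconv_half_plane:
  assumes "p \<in> Pd d {z. Re (\<omega> * z) \<le> a}" "q \<in> Pd d {z. Re (\<omega> * z) \<le> b}" "poly (ffconv d p q) y = 0"
  shows "Re (\<omega> * y) \<le> a + b"
  using assms
proof (induction d arbitrary: p q)
  case 0
  have "degree (ffconv 0 p q) = 0" "coeff (ffconv 0 p q) 0 = 1"
    using degree_ffconv lead_coeff_ffconv 0 by blast+
  thus ?case using "0.prems"(3) by (auto elim!: degree_eq_zeroE)
next
  case (Suc d)
  obtain \<mu> where \<mu>: "poly p \<mu> = 0" "Re (\<omega> * \<mu>) \<le> a"
    using Pd_root_exists[OF Suc.prems(1)] by auto
  obtain u where u: "p = [:-\<mu>, 1:] * u" "u \<in> Pd d {z. Re (\<omega> * z) \<le> a}"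
    using Pd_Suc_factor[OF Suc.prems(1) \<mu>(1)] .
  show ?case
  proof (rule ccontr)
    assume *: "\<not> ?thesis"
    hence "Re (\<omega> * (y - \<mu>)) > b" using \<mu> by (simp add: ring_distribs)
    then obtain \<kappa> where \<kappa>: "\<kappa> \<noteq> 0" "smult \<kappa> (polar_deriv (Suc d) (y - \<mu>) q) \<in> Pd d {z. Re (\<omega> * z) \<le> b}"
      using polar_deriv_half_plane Suc.prems(2) by blast
    have "poly (ffconv d u (polar_deriv (Suc d) (y - \<mu>) q)) y = 0"
      using poly_ffconv_linear_mult[of u d q \<mu> "y - \<mu>"] u Suc.prems by (simp add: PdD)
    hence "poly (ffconv d u (smult \<kappa> (polar_deriv (Suc d) (y - \<mu>) q))) y = 0"
      by (simp add: ffconv_smult_right)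
    thus False using Suc.IH[OF u(2) \<kappa>(2)] * by blast
  qed
qed

section \<open>Real-rooted pencils\<close>

lemma Pd_mono: "p \<in> Pd d K \<Longrightarrow> K \<subseteq> L \<Longrightarrow> p \<in> Pd d L"
  by (auto simp: Pd_def)

text \<open>The real line is the intersection of the closed upper and lower half-planes, and Grace's
  theorem applies to each.\<close>

lemma ffconv_real_rooted:
  assumes "p \<in> Pd d \<real>" "q \<in> Pd d \<real>"
  shows "ffconv d p q \<in> Pd d \<real>"
proof -
  have "\<real> \<subseteq> {z. Re (\<i> * z) \<le> 0}" "\<real> \<subseteq> {z. Re (- \<i> * z) \<le> 0}" by (auto elim!: Reals_cases)
  hence "Re (\<i> * y) \<le> 0 + 0" "Re (- \<i> * y) \<le> 0 + 0" if "poly (ffconv d p q) y = 0" for y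
    using assms that by (blast intro: ffconv_half_plane Pd_mono)+
  hence "Im y = 0" if "poly (ffconv d p q) y = 0" for y using that by (fastforce intro: order.antisym)
  thus ?thesis using lead_coeff_ffconv[OF assms] degree_ffconv[OF assms]
    by (auto simp: Pd_def complex_is_Real_iff)
qed

text \<open>Equivalently, \<open>W / F\<close> maps the open upper half-plane to the open lower one and vice versa.\<close>
definition anti_nevanlinna :: "complex poly \<Rightarrow> complex poly \<Rightarrow> bool" where
  "anti_nevanlinna F W \<longleftrightarrow> (\<forall>y. Im y \<noteq> 0 \<longrightarrow> Im y * Im (poly W y * cnj (poly F y)) < 0)"

text \<open>\<open>q' / q\<close> is the sum of the \<open>1 / (y - r i)\<close>, and for real
  \<open>r i\<close> each has imaginary part of sign opposite to \<open>Im y\<close>.\<close>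

lemma anti_nevanlinna_pderiv:
  assumes q: "q \<in> Pd (Suc d) \<real>"
  shows "anti_nevanlinna q (pderiv q)"
  unfolding anti_nevanlinna_def
proof (intro allI impI)
  fix y assume y: "Im y \<noteq> 0"
  obtain r where r: "q = (\<Prod>i<Suc d. [:- r i, 1:])" and rb: "\<And>i. i < Suc d \<Longrightarrow> r i \<in> \<real>"
    using monic_complex_poly_factors[OF q] by auto
  have nz: "y - r i \<noteq> 0" if "i < Suc d" for i using rb[OF that] y by (auto simp: complex_is_Real_iff)
  have qy: "poly q y \<noteq> 0" unfolding r poly_prod using nz by (simp del: prod.lessThan_Suc)
  have "poly (\<Prod>j\<in>{..<Suc d} - {i}. [:- r j, 1:]) y = poly q y / (y - r i)" if "i < Suc d" for i
    using that nz[OF that] unfolding r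
    by (subst (2) prod.remove[of _ i]) (auto simp: field_simps simp del: prod.lessThan_Suc)
  hence "poly (pderiv q) y = poly q y * (\<Sum>i<Suc d. 1 / (y - r i))"
    by (subst r, subst pderiv_prod)
       (simp add: pderiv_pCons poly_sum sum_distrib_left del: prod.lessThan_Suc sum.lessThan_Suc)
  hence "poly (pderiv q) y * cnj (poly q y) = of_real ((cmod (poly q y))\<^sup>2) * (\<Sum>i<Suc d. 1 / (y - r i))"
    by (simp only: complex_norm_square mult_ac)
  hence "Im y * Im (poly (pderiv q) y * cnj (poly q y)) = (cmod (poly q y))\<^sup>2 * (\<Sum>i<Suc d. Im y * Im (1 / (y - r i)))"
    by (simp only: Im_sum sum_distrib_left mult_ac Re_complex_of_real Im_complex_of_real times_complex.simps) simp
  also have "\<dots> < 0"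
  proof -
    have "Im y * Im (1 / (y - r i)) < 0" if "i < Suc d" for i
    proof -
      have "Im (1 / (y - r i)) = - Im y / (cmod (y - r i))\<^sup>2"
        using rb[OF that] by (simp add: Im_divide cmod_power2 complex_is_Real_iff)
      thus ?thesis using y nz[OF that] by (simp add: divide_neg_pos flip: power2_eq_square)
    qed
    hence "(\<Sum>i<Suc d. Im y * Im (1 / (y - r i))) < (\<Sum>i<Suc d. 0)"
      by (intro sum_strict_mono) auto
    thus ?thesis using qy by (simp add: mult_pos_neg del: sum.lessThan_Suc)
  qed
  finally show "Im y * Im (poly (pderiv q) y * cnj (poly q y)) < 0" .
qed

definition monic_pderiv :: "complex poly \<Rightarrow> complex poly" where
  "monic_pderiv q = smult (1 / of_nat (degree q)) (pderiv q)"

text \<open>A nonreal zero of the derivative would violate the strict inequality in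
  \<open>anti_nevanlinna q (pderiv q)\<close>.\<close>

lemma monic_pderiv_real_rooted:
  assumes "q \<in> Pd (Suc d) \<real>"
  shows "monic_pderiv q \<in> Pd d \<real>"
proof -
  have "degree (monic_pderiv q) = d" "coeff (monic_pderiv q) d = 1"
    using PdD(1,2)[OF assms] by (auto simp: monic_pderiv_def degree_pderiv coeff_pderiv simp del: of_nat_Suc)
  moreover have "z \<in> \<real>" if "poly (monic_pderiv q) z = 0" for z
  proof (rule ccontr)
    have "poly (pderiv q) z = 0"
      using that PdD(1)[OF assms] by (simp add: monic_pderiv_def del: of_nat_Suc)
    moreover assume "z \<notin> \<real>"
    ultimately show False
      using anti_nevanlinna_pderiv[OF assms] by (force simp: anti_nevanlinna_def complex_is_Real_iff)
  qed
  ultimately show ?thesis by (auto simp: Pd_def)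
qed

lemma ffconv_monic_pderiv:
  assumes "u \<in> Pd d K" "q \<in> Pd (Suc d) L"
  shows "ffconv (Suc d) u q = ffconv d u (monic_pderiv q)"
  using ffconv_Suc[of u d q] assms by (simp add: PdD monic_pderiv_def)

text \<open>Moving one root moves the convolution along an affine pencil with direction
  \<open>ffconv d u q\<close>.\<close>

lemma ffconv_linear_mult_eq:
  "ffconv d ([:-\<mu>, 1:] * u) q = ffconv d ([:-\<nu>, 1:] * u) q - smult (\<mu> - \<nu>) (ffconv d u q)"
proof -
  have "[:-\<mu>, 1:] * u = [:-\<nu>, 1:] * u - smult (\<mu> - \<nu>) u" by (simp add: smult_diff_left)
  thus ?thesis by (simp only: ffconv_diff_left ffconv_smult_left)
qed

text \<open>A value \<open>\<mu> - \<nu>\<close> of \<open>F / W\<close> at \<open>y\<close> means that moving the root \<open>\<nu>\<close> of the first factor to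
  \<open>\<mu>\<close> produces a root at \<open>y\<close>; hence \<open>\<mu>\<close> and \<open>y\<close> lie on the same side of the real line.\<close>
lemma anti_nevanlinna_ffconv:
  assumes u: "u \<in> Pd d \<real>" and \<nu>: "\<nu> \<in> \<real>" and q: "q \<in> Pd (Suc d) \<real>"
  shows "anti_nevanlinna (ffconv (Suc d) ([:-\<nu>, 1:] * u) q) (ffconv (Suc d) u q)"
  unfolding anti_nevanlinna_def
proof (intro allI impI)
  fix y assume y: "Im y \<noteq> 0"
  define F W where "F = ffconv (Suc d) ([:-\<nu>, 1:] * u) q" and "W = ffconv (Suc d) u q"
  have "W \<in> Pd d \<real>"
    unfolding W_def ffconv_monic_pderiv[OF u q]
    by (intro ffconv_real_rooted u monic_pderiv_real_rooted q)
  from PdD(4)[OF this, of y] have Wy: "poly W y \<noteq> 0" using y by (auto simp: complex_is_Real_iff)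
  define g where "g = poly F y / poly W y"
  \<comment> \<open>Multiplication by \<open>\<omega>\<close> turns the half-plane opposite to
    \<open>y\<close> into \<open>Re z \<le> 0\<close>.\<close>
  define \<omega> where "\<omega> = - \<i> * sgn (Im y)"
  have \<omega>: "Re (\<omega> * z) = sgn (Im y) * Im z" for z by (simp add: \<omega>_def)
  have "Re (\<omega> * g) > 0"
  proof (rule ccontr)
    assume "\<not> ?thesis"
    hence *: "Re (\<omega> * (\<nu> + g)) \<le> 0" using \<nu> unfolding \<omega> by (simp add: complex_is_Real_iff)
    let ?H = "{z. Re (\<omega> * z) \<le> 0}"
    have R: "\<real> \<subseteq> ?H" unfolding \<omega> by (auto simp: complex_is_Real_iff)
    \<comment> \<open>If \<open>g\<close> were not strictly on the side of \<open>y\<close>, both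
      factors would have all roots in the opposite closed half-plane, while \<open>y\<close> is a
      root of their convolution.\<close>
    have "[:-(\<nu> + g), 1:] * u \<in> Pd (Suc d) ?H"
    proof -
      have "degree ([:-(\<nu> + g), 1:] * u) = Suc d" using u by (subst degree_mult_eq) (auto simp: PdD)
      moreover have "lead_coeff ([:-(\<nu> + g), 1:] * u) = 1" using u by (subst lead_coeff_mult) (auto simp: PdD)
      moreover have "z \<in> ?H" if "poly ([:-(\<nu> + g), 1:] * u) z = 0" for z
      proof -
        have "(z - (\<nu> + g)) * poly u z = 0" using that by (simp add: algebra_simps)
        hence "z = \<nu> + g \<or> z \<in> \<real>" using PdD(4)[OF u] by auto
        thus ?thesis using * R by blast
      qed
      ultimately show ?thesis unfolding Pd_def by blast
    qed
    moreover have "q \<in> Pd (Suc d) ?H" using Pd_mono[OF q R] .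
    moreover have "poly (ffconv (Suc d) ([:-(\<nu> + g), 1:] * u) q) y = 0"
      unfolding ffconv_linear_mult_eq[of _ "\<nu> + g" _ _ \<nu>] F_def[symmetric] W_def[symmetric]
      using Wy by (simp add: g_def)
    ultimately have "Re (\<omega> * y) \<le> 0 + 0" by (rule ffconv_half_plane)
    thus False using y unfolding \<omega> by (simp add: sgn_if split: if_splits)
  qed
  hence g: "Im y * Im g > 0" using y unfolding \<omega> by (simp add: sgn_if mult_neg_neg split: if_splits)
  have "poly W y * cnj (poly F y) = of_real ((cmod (poly W y))\<^sup>2) * cnj g"
    using Wy by (simp add: g_def complex_norm_square del: of_real_power)
  hence "Im (poly W y * cnj (poly F y)) = - ((cmod (poly W y))\<^sup>2 * Im g)"
    by (simp del: of_real_power)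
  thus "Im y * Im (poly W y * cnj (poly F y)) < 0"
    using g Wy by (simp add: mult.left_commute[of "Im y"])
qed

text \<open>Approach \<open>r\<close> along \<open>r + e \<omega>\<close> with \<open>e\<close>
  decreasing to 0. The extracted powers contribute the positive factor \<open>e ^ (a + b)\<close>;
  dividing by it leaves a weak inequality in the limit.\<close>

lemma anti_nevanlinna_local:
  fixes r :: real
  assumes nev: "anti_nevanlinna ([:- of_real r, 1:] ^ b * F) ([:- of_real r, 1:] ^ a * W)" and \<omega>: "Im \<omega> \<noteq> 0"
  shows "Im \<omega> * Im (\<omega> ^ a * cnj \<omega> ^ b * (poly W (of_real r) * cnj (poly F (of_real r)))) \<le> 0"
proof (rule tendsto_upperbound)
  let ?f = "\<lambda>e. Im \<omega> * Im (\<omega> ^ a * cnj \<omega> ^ b * (poly W (of_real r + of_real e * \<omega>) * cnj (poly F (of_real r + of_real e * \<omega>))))"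
  have "(?f \<longlongrightarrow> ?f 0) (at_right 0)" by (intro tendsto_intros)
  thus "(?f \<longlongrightarrow> Im \<omega> * Im (\<omega> ^ a * cnj \<omega> ^ b * (poly W (of_real r) * cnj (poly F (of_real r))))) (at_right 0)"
    by simp
  show "\<forall>\<^sub>F e in at_right 0. ?f e \<le> 0"
    using eventually_at_right_less[of "0::real"]
  proof eventually_elim
    case (elim e)
    let ?y = "of_real r + of_real e * \<omega>"
    have "Im ?y * Im (poly ([:- of_real r, 1:] ^ a * W) ?y * cnj (poly ([:- of_real r, 1:] ^ b * F) ?y)) < 0"
      by (rule nev[unfolded anti_nevanlinna_def, rule_format]) (use \<omega> elim in auto)
    moreover have "poly ([:- of_real r, 1:] ^ a * W) ?y * cnj (poly ([:- of_real r, 1:] ^ b * F) ?y)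
      = of_real (e ^ (a + b)) * (\<omega> ^ a * cnj \<omega> ^ b * (poly W ?y * cnj (poly F ?y)))"
      by (simp add: power_mult_distrib power_add mult_ac)
    hence "Im (poly ([:- of_real r, 1:] ^ a * W) ?y * cnj (poly ([:- of_real r, 1:] ^ b * F) ?y))
      = e ^ (a + b) * Im (\<omega> ^ a * cnj \<omega> ^ b * (poly W ?y * cnj (poly F ?y)))"
      by (metis Im_complex_of_real Re_complex_of_real add_cancel_right_right mult_zero_left times_complex.simps(2))
    ultimately have "e * e ^ (a + b) * ?f e < 0" by (simp add: mult_ac)
    moreover have "0 \<le> e * e ^ (a + b)" using elim by simp
    ultimately show ?case by (meson linorder_not_le mult_nonneg_nonneg order_less_imp_le)
  qed
qed simp

text \<open>Near \<open>r\<close>, \<open>W / F\<close> is a constant times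
  \<open>(x - r)^(-j)\<close> to leading order. Over a half circle about \<open>r\<close> its
  argument turns by \<open>j * pi\<close>, so for \<open>j \<ge> 2\<close> it cannot stay in one
  half-plane.\<close>

lemma anti_nevanlinna_order:
  fixes r :: real
  assumes nev: "anti_nevanlinna F W" and nz: "F \<noteq> 0" "W \<noteq> 0"
  shows "order (of_real r) F \<le> Suc (order (of_real r) W)"
proof (rule ccontr)
  assume *: "\<not> ?thesis"
  define a b where "a = order (of_real r) W" and "b = order (of_real r) F"
  define j where "j = b - a"
  have j: "j \<ge> 2" "b = a + j" using * by (auto simp: a_def b_def j_def)
  obtain F1 where F1: "F = [:- of_real r, 1:] ^ b * F1" "\<not> [:- of_real r, 1:] dvd F1"
    using order_decomp[OF nz(1), of "of_real r"] by (auto simp: b_def)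
  obtain W1 where W1: "W = [:- of_real r, 1:] ^ a * W1" "\<not> [:- of_real r, 1:] dvd W1"
    using order_decomp[OF nz(2), of "of_real r"] by (auto simp: a_def)
  define \<kappa> where "\<kappa> = poly W1 (of_real r) * cnj (poly F1 (of_real r))"
  have "\<kappa> \<noteq> 0" using F1(2) W1(2) by (simp add: \<kappa>_def poly_eq_0_iff_dvd)
  have main: "sin \<theta> * Im (cis (- (real j * \<theta>)) * \<kappa>) \<le> 0" if "sin \<theta> \<noteq> 0" for \<theta>
  proof -
    have "cis \<theta> ^ a * cnj (cis \<theta>) ^ b = cis (- (real j * \<theta>))"
      unfolding j cis_cnj Complex.DeMoivre by (simp add: cis_mult algebra_simps)
    thus ?thesis
      using anti_nevanlinna_local[of r b F1 a W1 "cis \<theta>"] nev that F1(1) W1(1) by (simp add: \<kappa>_def)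
  qed
  have pos: "Im (cis (- t) * \<kappa>) \<le> 0" "Im (cis t * \<kappa>) \<ge> 0" if t: "0 < t" "t < 2 * pi" for t
  proof -
    have "pi * 2 \<le> pi * real j" using j(1) by (intro mult_left_mono) auto
    hence "t < pi * real j" using t by linarith
    hence "0 < t / real j" "t / real j < pi" using t j(1) by (auto simp: field_simps)
    hence s: "sin (t / real j) > 0" by (rule sin_gt_zero)
    show "Im (cis (- t) * \<kappa>) \<le> 0" "Im (cis t * \<kappa>) \<ge> 0"
      using main[of "t / real j"] main[of "- (t / real j)"] s j(1)
      by (simp_all add: mult_le_0_iff zero_le_mult_iff del: cis.simps times_complex.simps)
  qed
  \<comment> \<open>The angles \<open>pi / 2\<close> and \<open>3 / 2 * pi\<close> bound
    \<open>Re \<kappa>\<close> from both sides, and \<open>pi\<close> does so for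
    \<open>Im \<kappa>\<close>.\<close>
  have "sin (3 / 2 * pi) = -1" "cos (3 / 2 * pi) = 0"
    using sin_3over2_pi cos_3over2_pi by (simp_all add: mult.commute)
  hence "Re \<kappa> = 0"
    using pos[of "pi / 2"] pos[of "3 / 2 * pi"] by (simp del: times_divide_eq_left)
  moreover have "Im \<kappa> = 0"
    using pos[of pi] by simp
  ultimately show False using \<open>\<kappa> \<noteq> 0\<close> by (simp add: complex_eq_iff)
qed

text \<open>If \<open>F\<close> is nonzero at \<open>r\<close>, this is a positive multiple of the
  residue of the quotient at \<open>r\<close>. The vertical direction gives its sign; the slanted
  directions \<open>1 + \<delta> \<i>\<close> force it to be real.\<close>

lemma anti_nevanlinna_residue:
  fixes r :: real
  assumes nev: "anti_nevanlinna ([:- of_real r, 1:] * F) W"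
  shows "poly W (of_real r) * cnj (poly F (of_real r)) \<in> \<real>" "Re (poly W (of_real r) * cnj (poly F (of_real r))) \<ge> 0"
proof -
  define \<kappa> where "\<kappa> = poly W (of_real r) * cnj (poly F (of_real r))"
  have main: "Im \<omega> * Im (cnj \<omega> * \<kappa>) \<le> 0" if "Im \<omega> \<noteq> 0" for \<omega>
    using anti_nevanlinna_local[of r 1 F 0 W \<omega>] that nev by (simp add: \<kappa>_def)
  from main[of \<i>] show re: "Re (poly W (of_real r) * cnj (poly F (of_real r))) \<ge> 0"
    by (simp add: \<kappa>_def)
  have slope: "\<delta> * (Im \<kappa> - \<delta> * Re \<kappa>) \<le> 0" if "\<delta> \<noteq> 0" for \<delta>
    using main[of "Complex 1 \<delta>"] that by (simp add: algebra_simps)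
  have "Im \<kappa> = 0"
  proof (rule ccontr)
    assume nz: "Im \<kappa> \<noteq> 0"
    \<comment> \<open>Chosen so that \<open>Im \<kappa> - \<delta> * Re \<kappa> = \<delta> * (Re
      \<kappa> + 2)\<close>; the shift by 1 keeps the denominator positive.\<close>
    define \<delta> where "\<delta> = Im \<kappa> / (2 * (Re \<kappa> + 1))"
    have "Re \<kappa> \<ge> 0" using re by (simp add: \<kappa>_def)
    hence "\<delta> \<noteq> 0" "Im \<kappa> - \<delta> * Re \<kappa> = \<delta> * (Re \<kappa> + 2)"
      using nz by (auto simp: \<delta>_def field_simps)
    hence "\<delta> * \<delta> * (Re \<kappa> + 2) \<le> 0" using slope[of \<delta>] by (simp add: mult.assoc)
    moreover have "\<delta> * \<delta> > 0" using \<open>\<delta> \<noteq> 0\<close> not_real_square_gt_zero by blast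
    ultimately show False using \<open>Re \<kappa> \<ge> 0\<close> mult_pos_pos[of "\<delta> * \<delta>" "Re \<kappa> + 2"] by linarith
  qed
  thus "poly W (of_real r) * cnj (poly F (of_real r)) \<in> \<real>"
    by (simp add: \<kappa>_def complex_is_Real_iff)
qed

section \<open>Interlacing\<close>

lemma complex_poly_dvdI_order:
  fixes p q :: "complex poly"
  assumes "p \<noteq> 0" "q \<noteq> 0" "\<And>z. order z p \<le> order z q"
  shows "p dvd q"
  using assms
proof (induction "degree p" arbitrary: p q)
  case 0
  hence "is_unit p" by (simp add: is_unit_iff_degree)
  thus ?case by (rule unit_imp_dvd)
next
  case (Suc n)
  obtain z where z: "poly p z = 0"
    using alg_closed_imp_poly_has_root[of p] Suc.hyps by auto
  hence "order z p > 0" using Suc.prems by (simp add: order_gt_0_iff)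
  hence "poly q z = 0" using Suc.prems by (metis order_gt_0_iff order_less_le_trans)
  with z obtain p' q' where pq: "p = [:-z, 1:] * p'" "q = [:-z, 1:] * q'"
    unfolding poly_eq_0_iff_dvd by (elim dvdE)
  have nz: "p' \<noteq> 0" "q' \<noteq> 0" using pq Suc.prems by auto
  have "p' dvd q'"
  proof (rule Suc.hyps(1))
    show "n = degree p'" using Suc.hyps(2) nz unfolding pq by (subst (asm) degree_mult_eq) auto
    fix w
    show "order w p' \<le> order w q'"
      using Suc.prems(3)[of w] Suc.prems(1,2) unfolding pq by (simp add: order_mult del: mult_pCons_left)
  qed (use nz in auto)
  thus ?case unfolding pq by (rule mult_dvd_mono[OF dvd_refl])
qed

definition nodal_poly :: "real set \<Rightarrow> complex poly" where
  "nodal_poly S = (\<Prod>s\<in>S. [:- of_real s, 1:])"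

text \<open>The numerator of the sum of the \<open>c s / (x - s)\<close> over the common denominator
  \<open>nodal_poly S\<close>.\<close>

definition residue_poly :: "real set \<Rightarrow> (real \<Rightarrow> real) \<Rightarrow> complex poly" where
  "residue_poly S c = (\<Sum>s\<in>S. smult (of_real (c s)) (nodal_poly (S - {s})))"

lemma nodal_poly_nz [simp]: "nodal_poly S \<noteq> 0"
  by (cases "finite S") (auto simp: nodal_poly_def)

lemma degree_nodal_poly: "finite S \<Longrightarrow> degree (nodal_poly S) = card S"
  unfolding nodal_poly_def by (subst degree_prod_sum_eq) auto

lemma poly_nodal_poly: "poly (nodal_poly S) z = (\<Prod>s\<in>S. z - of_real s)"
  by (simp add: nodal_poly_def poly_prod)

lemma nodal_poly_remove:
  assumes "finite S" "s \<in> S"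
  shows "nodal_poly S = [:- of_real s, 1:] * nodal_poly (S - {s})"
  unfolding nodal_poly_def by (rule prod.remove[OF assms])

lemma nodal_poly_Un:
  assumes "finite S" "finite T" "S \<inter> T = {}"
  shows "nodal_poly (S \<union> T) = nodal_poly S * nodal_poly T"
  unfolding nodal_poly_def by (rule prod.union_disjoint[OF assms])

lemma poly_nodal_poly_0_iff: "finite S \<Longrightarrow> poly (nodal_poly S) (of_real x) = 0 \<longleftrightarrow> x \<in> S"
  by (simp add: poly_nodal_poly)

text \<open>A certificate that the zeros of \<open>W\<close> interlace those of \<open>F\<close>: the partial fraction expansion
  of \<open>W / F\<close> is \<open>\<Sum>s\<in>S. c s / (x - s)\<close> with positive residues.\<close>
definition interlacing :: "complex poly \<Rightarrow> complex poly \<Rightarrow> bool" where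
  "interlacing F W \<longleftrightarrow> (\<exists>H S c. finite S \<and> S \<noteq> {} \<and> H \<noteq> 0 \<and> (\<forall>s\<in>S. c s > 0) \<and>
     F = H * nodal_poly S \<and> W = H * residue_poly S c)"

lemma lagrange_interpolation_real_nodes:
  fixes V :: "complex poly"
  assumes R: "finite R" and deg: "degree V < card R"
  shows "V = (\<Sum>r\<in>R. smult (poly V (of_real r) / poly (nodal_poly (R - {r})) (of_real r)) (nodal_poly (R - {r})))"
    (is "V = ?L")
proof (rule poly_eqI_degree)
  have "degree (nodal_poly (R - {r})) < card R" if "r \<in> R" for r
    using that R by (metis card_Diff1_less degree_nodal_poly finite_Diff)
  hence "degree ?L < card R"
    using deg by (intro degree_sum_less) (auto intro: le_less_trans[OF degree_smult_le])
  moreover have c: "card (of_real ` R :: complex set) = card R"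
    by (rule card_image) (auto simp: inj_on_def)
  ultimately show "card (of_real ` R :: complex set) > degree ?L" by simp
  show "card (of_real ` R :: complex set) > degree V" using deg c by simp
  fix x :: complex assume "x \<in> of_real ` R"
  then obtain t where t: "t \<in> R" "x = of_real t" by auto
  let ?c = "\<lambda>r. poly V (of_real r) / poly (nodal_poly (R - {r})) (of_real r)"
  have "poly ?L x = (\<Sum>r\<in>R. ?c r * poly (nodal_poly (R - {r})) x)"
    by (simp add: poly_sum)
  also have "\<dots> = (\<Sum>r\<in>{t}. ?c r * poly (nodal_poly (R - {r})) x)"
    using R t poly_nodal_poly_0_iff[of "R - {r}" t for r]
    by (intro sum.mono_neutral_right) auto
  also have "\<dots> = poly V x"
    using t R poly_nodal_poly_0_iff[of "R - {t}" t] by simp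
  finally show "poly V x = poly ?L x" by simp
qed

lemma residue_poly_restrict:
  assumes R: "finite R" "S \<subseteq> R" and c: "\<And>r. r \<in> R - S \<Longrightarrow> c r = 0"
  shows "residue_poly R c = nodal_poly (R - S) * residue_poly S c"
proof -
  have "residue_poly R c = (\<Sum>s\<in>S. smult (of_real (c s)) (nodal_poly (R - {s})))"
    unfolding residue_poly_def using R c by (intro sum.mono_neutral_right) auto
  also have "nodal_poly (R - {s}) = nodal_poly (R - S) * nodal_poly (S - {s})" if "s \<in> S" for s
  proof -
    have "R - {s} = (R - S) \<union> (S - {s})" using that R by auto
    thus ?thesis using R by (subst nodal_poly_Un[symmetric]) (auto intro: finite_subset)
  qed
  hence "(\<Sum>s\<in>S. smult (of_real (c s)) (nodal_poly (R - {s}))) = nodal_poly (R - S) * residue_poly S c"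
    unfolding residue_poly_def sum_distrib_left by (intro sum.cong) auto
  finally show ?thesis .
qed

text \<open>By the order bound the repeated part \<open>G\<close> of \<open>F\<close> divides
  \<open>W\<close>, so \<open>W / F\<close> has only simple real poles; Lagrange interpolation reads
  off the residues, which are nonnegative.\<close>

lemma anti_nevanlinna_imp_interlacing:
  assumes nev: "anti_nevanlinna F W" and F: "F \<in> Pd d \<real>" and W: "W \<noteq> 0" "degree W < d"
  shows "interlacing F W"
proof -
  define R where "R = {r::real. poly F (of_real r) = 0}"
  have F0: "F \<noteq> 0" using F by (simp add: PdD)
  have roots: "{z. poly F z = 0} = of_real ` R"
    using PdD(4)[OF F] by (auto simp: R_def elim!: Reals_cases)
  have fin: "finite R"
    using poly_roots_finite[OF F0] unfolding roots by (rule finite_imageD) (auto simp: inj_on_def)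
  define G :: "complex poly" where "G = (\<Prod>r\<in>R. [:- of_real r, 1:] ^ (order (of_real r) F - 1))"
  have "F = (\<Prod>z\<in>of_real ` R. [:-z, 1:] ^ order z F)"
    using complex_poly_decompose[of F] F unfolding roots by (simp add: PdD)
  also have "\<dots> = (\<Prod>r\<in>R. [:- of_real r, 1:] ^ order (of_real r) F)"
    by (subst prod.reindex) (auto simp: inj_on_def)
  also have "\<dots> = nodal_poly R * G"
    unfolding nodal_poly_def G_def prod.distrib[symmetric]
    using F0 by (intro prod.cong refl) (auto simp: R_def order_gt_0_iff simp flip: power_Suc simp del: mult_pCons_left)
  finally have FG: "F = nodal_poly R * G" .
  have G0: "G \<noteq> 0" unfolding G_def by (auto simp: fin)
  have ord_nodal: "order (of_real r) (nodal_poly R) \<ge> 1" if "r \<in> R" for r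
    using that fin poly_nodal_poly_0_iff[of R r] order_gt_0_iff[of "nodal_poly R" "of_real r"] by simp
  have "G dvd W"
  proof (rule complex_poly_dvdI_order[OF G0 W(1)])
    fix z
    show "order z G \<le> order z W"
    proof (cases "z \<in> of_real ` R")
      case True
      then obtain r where r: "z = of_real r" "r \<in> R" by auto
      have "order z F = order z (nodal_poly R) + order z G"
        using G0 unfolding FG by (subst order_mult) auto
      thus ?thesis using ord_nodal[OF r(2)] anti_nevanlinna_order[OF nev F0 W(1), of r] r by simp
    next
      case False
      hence "poly G z \<noteq> 0" by (auto simp: G_def poly_prod fin)
      thus ?thesis by (simp add: order_0I)
    qed
  qed
  then obtain V where V: "W = G * V" by blast
  \<comment> \<open>Cancelling \<open>G\<close> divides out the square of
    \<open>cmod (poly G y)\<close>, so the sign survives.\<close>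
  have nevV: "anti_nevanlinna (nodal_poly R) V"
    unfolding anti_nevanlinna_def
  proof (intro allI impI)
    fix y assume y: "Im y \<noteq> 0"
    let ?v = "Im (poly V y * cnj (poly (nodal_poly R) y))"
    have "poly W y * cnj (poly F y) = of_real ((cmod (poly G y))\<^sup>2) * (poly V y * cnj (poly (nodal_poly R) y))"
      by (simp add: V FG complex_norm_square mult_ac del: of_real_power)
    hence "Im (poly W y * cnj (poly F y)) = (cmod (poly G y))\<^sup>2 * ?v"
      by (metis Im_complex_of_real Re_complex_of_real add_cancel_right_right mult_zero_left times_complex.simps(2))
    hence "(cmod (poly G y))\<^sup>2 * (Im y * ?v) < 0"
      using nev[unfolded anti_nevanlinna_def, rule_format, OF y] by (simp add: mult.left_commute)
    thus "Im y * ?v < 0" by (meson linorder_not_le mult_nonneg_nonneg zero_le_power2)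
  qed
  have "degree V < card R"
  proof -
    have "V \<noteq> 0" using V W by auto
    hence "degree W = degree G + degree V" unfolding V using G0 by (rule_tac degree_mult_eq)
    moreover have "d = card R + degree G"
      using F fin degree_mult_eq[of "nodal_poly R" G] G0 FG by (simp add: PdD degree_nodal_poly)
    ultimately show ?thesis using W by simp
  qed
  note L = lagrange_interpolation_real_nodes[OF fin this]
  define c where "c r = Re (poly V (of_real r) / poly (nodal_poly (R - {r})) (of_real r))" for r
  have c: "poly V (of_real r) / poly (nodal_poly (R - {r})) (of_real r) = of_real (c r)" "c r \<ge> 0" if r: "r \<in> R" for r
  proof -
    let ?k = "poly V (of_real r) * cnj (poly (nodal_poly (R - {r})) (of_real r))"
    have k: "?k \<in> \<real>" "Re ?k \<ge> 0"
      using anti_nevanlinna_residue[of r "nodal_poly (R - {r})" V] nevV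
      by (simp_all only: nodal_poly_remove[OF fin r, symmetric])
    have "poly V (of_real r) / poly (nodal_poly (R - {r})) (of_real r) = ?k / of_real ((cmod (poly (nodal_poly (R - {r})) (of_real r)))\<^sup>2)"
      by (subst complex_div_cnj) simp
    moreover have "?k = of_real (Re ?k)" using k(1) by (simp add: complex_is_Real_iff complex_eq_iff)
    ultimately have eq: "poly V (of_real r) / poly (nodal_poly (R - {r})) (of_real r) = of_real (Re ?k / (cmod (poly (nodal_poly (R - {r})) (of_real r)))\<^sup>2)"
      by (metis of_real_divide)
    show "poly V (of_real r) / poly (nodal_poly (R - {r})) (of_real r) = of_real (c r)" "c r \<ge> 0"
      unfolding c_def eq using k(2) by (simp_all only: Re_complex_of_real) simp
  qed
  have VR: "V = residue_poly R c"
    unfolding residue_poly_def by (subst L) (intro sum.cong, auto simp: c)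
  \<comment> \<open>Nodes with residue 0 move into the common factor, because the certificate asks
    for positive residues.\<close>
  define S where "S = {r\<in>R. c r > 0}"
  have c0: "c r = 0" if "r \<in> R - S" for r
    using that c(2)[of r] by (force simp: S_def)
  have SR: "S \<subseteq> R" "finite S" using fin by (auto simp: S_def)
  have "S \<noteq> {}"
  proof
    assume "S = {}"
    hence "V = 0" unfolding VR residue_poly_def using c0 by (intro sum.neutral) auto
    thus False using V W by simp
  qed
  moreover have "nodal_poly R = nodal_poly (R - S) * nodal_poly S"
    using fin SR by (subst nodal_poly_Un[symmetric]) (auto simp: Un_absorb2)
  moreover have "V = nodal_poly (R - S) * residue_poly S c"
    unfolding VR using fin SR c0 by (intro residue_poly_restrict) auto
  ultimately show ?thesis
    unfolding interlacing_def using SR G0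
    by (intro exI[of _ "G * nodal_poly (R - S)"] exI[of _ S] exI[of _ c])
       (auto simp: V FG mult_ac S_def)
qed

section \<open>Counting roots\<close>

lemma poly_residue_poly:
  fixes x :: real
  assumes S: "finite S" and x: "x \<notin> S"
  shows "poly (residue_poly S c) (of_real x) = poly (nodal_poly S) (of_real x) * of_real (\<Sum>s\<in>S. c s / (x - s))"
proof -
  have "poly (nodal_poly (S - {s})) (of_real x) = poly (nodal_poly S) (of_real x) / of_real (x - s)" if "s \<in> S" for s
  proof -
    have "x \<noteq> s" using x that by auto
    thus ?thesis by (subst nodal_poly_remove[OF S that]) (simp add: field_simps)
  qed
  thus ?thesis
    by (simp add: residue_poly_def poly_sum sum_distrib_left) (auto intro!: sum.cong)
qed

lemma poly_residue_poly_node: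
  assumes S: "finite S" and s: "s \<in> S" "c s > 0"
  shows "poly (residue_poly S c) (of_real s) \<noteq> 0"
proof -
  have "poly (residue_poly S c) (of_real s) = (\<Sum>t\<in>S. of_real (c t) * poly (nodal_poly (S - {t})) (of_real s))"
    by (simp add: residue_poly_def poly_sum)
  also have "\<dots> = (\<Sum>t\<in>{s}. of_real (c t) * poly (nodal_poly (S - {t})) (of_real s))"
    using S s poly_nodal_poly_0_iff[of "S - {t}" s for t] by (intro sum.mono_neutral_right) auto
  finally show ?thesis using S s poly_nodal_poly_0_iff[of "S - {s}" s] by simp
qed

lemma residue_poly_root:
  assumes S: "finite S" and c: "\<forall>s\<in>S. c s > 0" and x: "poly (residue_poly S c) (of_real x) = 0"
  shows "x \<notin> S" "(\<Sum>s\<in>S. c s / (x - s)) = 0"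
proof -
  show "x \<notin> S" using poly_residue_poly_node[OF S] c x by blast
  from poly_residue_poly[OF S this] x show "(\<Sum>s\<in>S. c s / (x - s)) = 0"
    using S \<open>x \<notin> S\<close> by (simp add: poly_nodal_poly_0_iff del: of_real_sum)
qed

lemma residue_poly_nz:
  assumes "finite S" "S \<noteq> {}" "\<forall>s\<in>S. c s > 0"
  shows "residue_poly S c \<noteq> 0"
proof -
  obtain s where "s \<in> S" using assms(2) by blast
  thus ?thesis using poly_residue_poly_node[of S s c] assms by force
qed

text \<open>At a zero \<open>x\<close> of \<open>\<Sum>s\<in>S. c s / (x - s)\<close> the derivative \<open>- (\<Sum>s\<in>S. c s / (x - s)\<^sup>2)\<close> is negative.\<close>
lemma order_residue_poly_le:
  assumes S: "finite S" "S \<noteq> {}" and c: "\<forall>s\<in>S. c s > 0"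
  shows "order (of_real x) (residue_poly S c) \<le> 1"
proof (cases "poly (residue_poly S c) (of_real x) = 0")
  case True
  note x = residue_poly_root[OF S(1) c True]
  \<comment> \<open>With \<open>X\<close> the variable, subtracting the vanishing sum of
    \<open>c s / (x - s)\<close> from that of \<open>c s / (X - s)\<close> leaves
    \<open>X - x\<close> times a sum with weights \<open>- c s / (x - s)\<close>; \<open>T\<close>
    is its numerator.\<close>
  define T where "T = residue_poly S (\<lambda>s. - c s / (x - s))"
  have "residue_poly S c = [:- of_real x, 1:] * T"
  proof -
    have "[:- of_real x, 1:] * T = (\<Sum>s\<in>S. smult (of_real (c s)) (nodal_poly (S - {s}))
            - smult (of_real (c s / (x - s))) (nodal_poly S))"
      unfolding T_def residue_poly_def sum_distrib_left
    proof (intro sum.cong refl)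
      fix s assume s: "s \<in> S"
      hence ne: "of_real x - of_real s \<noteq> (0 :: complex)" using x by auto
      have eq: "[:- of_real x, 1:] = [:- of_real s, 1:] - [:of_real x - of_real s :: complex:]" by simp
      have "[:- of_real x, 1:] * nodal_poly (S - {s}) = nodal_poly S - smult (of_real x - of_real s) (nodal_poly (S - {s}))"
        unfolding eq left_diff_distrib nodal_poly_remove[OF S(1) s, symmetric] by simp
      thus "[:- of_real x, 1:] * smult (of_real (- c s / (x - s))) (nodal_poly (S - {s})) =
         smult (of_real (c s)) (nodal_poly (S - {s})) - smult (of_real (c s / (x - s))) (nodal_poly S)"
        using ne by (simp add: smult_diff_right del: mult_pCons_left)
    qed
    also have "\<dots> = residue_poly S c - smult (of_real (\<Sum>s\<in>S. c s / (x - s))) (nodal_poly S)"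
      by (simp add: residue_poly_def sum_subtractf smult_sum)
    finally show ?thesis using x by simp
  qed
  moreover have "poly T (of_real x) \<noteq> 0"
  proof -
    have "(\<Sum>s\<in>S. - c s / (x - s) / (x - s)) < (\<Sum>s\<in>S. 0)"
    proof (intro sum_strict_mono S)
      fix s assume "s \<in> S"
      hence "c s > 0" "x - s \<noteq> 0" using c x by auto
      hence "c s > 0" "(x - s) * (x - s) > 0" using not_real_square_gt_zero by blast+
      thus "- c s / (x - s) / (x - s) < 0" by (simp add: divide_neg_pos)
    qed
    thus ?thesis unfolding T_def using S(1) x(1)
      by (subst poly_residue_poly) (auto simp: poly_nodal_poly_0_iff simp del: of_real_sum)
  qed
  moreover have "residue_poly S c \<noteq> 0" using residue_poly_nz S c by blast
  ultimately have "order (of_real x) (residue_poly S c) = order (of_real x) [:- of_real x :: complex, 1:]"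
    by (metis add.right_neutral order_0I order_mult)
  also have "order (of_real x) [:- of_real x :: complex, 1:] = 1"
    using order_power_n_n[of "of_real x :: complex" 1] by simp
  finally show ?thesis by simp
qed (simp add: order_0I)

section \<open>Root counts with multiplicity on real sets\<close>

definition root_count :: "complex poly \<Rightarrow> real set \<Rightarrow> nat" where
  "root_count p A = size (filter_mset (\<lambda>z. z \<in> of_real ` A) (proots p))"

lemma root_count_mult: "p \<noteq> 0 \<Longrightarrow> q \<noteq> 0 \<Longrightarrow> root_count (p * q) A = root_count p A + root_count q A"
  by (simp add: root_count_def proots_mult)

lemma root_count_linear: "root_count [:- of_real s, 1:] A = (if s \<in> A then 1 else 0)"
  by (auto simp: root_count_def)

lemma root_count_nodal_poly: "finite S \<Longrightarrow> root_count (nodal_poly S) A = card (S \<inter> A)"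
proof (induction S rule: finite_induct)
  case (insert s S)
  have "root_count (nodal_poly (insert s S)) A = root_count [:- of_real s, 1:] A + root_count (nodal_poly S) A"
    using insert nodal_poly_remove[of "insert s S" s] by (simp add: root_count_mult del: mult_pCons_left)
  thus ?case using insert by (auto simp: root_count_linear)
qed (simp add: nodal_poly_def root_count_def)

lemma root_count_Compl:
  assumes "p \<in> Pd d \<real>"
  shows "root_count p A + root_count p (- A) = d"
proof -
  have "z \<notin> of_real ` A \<longleftrightarrow> z \<in> of_real ` (- A)" if "z \<in># proots p" for z
  proof -
    have "z \<in> \<real>" using that assms by (auto simp: PdD)
    thus ?thesis by (auto elim!: Reals_cases)
  qed
  hence "filter_mset (\<lambda>z. z \<in> of_real ` (- A)) (proots p) = filter_mset (\<lambda>z. z \<notin> of_real ` A) (proots p)"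
    by (intro filter_mset_cong) auto
  hence "root_count p A + root_count p (- A) = size (proots p)"
    unfolding root_count_def by (metis multiset_partition size_union)
  thus ?thesis using assms by (simp add: size_proots_complex PdD)
qed

lemma root_count_squarefree:
  assumes "p \<noteq> 0" and ord: "\<And>x::real. order (of_real x) p \<le> 1"
  shows "root_count p A = card {x\<in>A. poly p (of_real x) = 0}"
proof -
  let ?Z = "of_real ` {x\<in>A. poly p (of_real x) = 0} :: complex set"
  have "finite ?Z" using poly_roots_finite[OF assms(1)] by (rule finite_subset[rotated]) auto
  have "filter_mset (\<lambda>z. z \<in> of_real ` A) (proots p) = mset_set ?Z"
  proof (rule multiset_eqI)
    fix z
    show "count (filter_mset (\<lambda>z. z \<in> of_real ` A) (proots p)) z = count (mset_set ?Z) z"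
    proof (cases "z \<in> ?Z")
      case True
      then obtain x where x: "z = of_real x" "x \<in> A" "poly p (of_real x) = 0" by auto
      hence "order z p > 0" using assms(1) by (simp add: order_gt_0_iff)
      hence "order z p = 1" using ord[of x] x by simp
      thus ?thesis using True \<open>finite ?Z\<close> x assms(1) by simp
    next
      case False
      thus ?thesis using \<open>finite ?Z\<close> assms(1) by (auto simp: order_eq_0_iff)
    qed
  qed
  hence "root_count p A = card ?Z" by (simp add: root_count_def)
  also have "\<dots> = card {x\<in>A. poly p (of_real x) = 0}"
    by (rule card_image) (auto simp: inj_on_def)
  finally show ?thesis .
qed

text \<open>On an interval without poles every \<open>c s / (x - s)\<close> strictly decreases, so
  the sum vanishes at most once there.\<close>

lemma partial_fraction_zeros_separated:
  fixes c :: "real \<Rightarrow> real"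
  assumes S: "finite S" "S \<noteq> {}" and c: "\<forall>s\<in>S. c s > 0"
    and v: "v \<notin> S" "(\<Sum>s\<in>S. c s / (v - s)) = 0" and w: "w \<notin> S" "(\<Sum>s\<in>S. c s / (w - s)) = 0" and vw: "v < w"
  shows "\<exists>s\<in>S. v < s \<and> s < w"
proof (rule ccontr)
  assume none: "\<not> ?thesis"
  have "c s / (w - s) < c s / (v - s)" if s: "s \<in> S" for s
  proof -
    have "(v - s) * (w - s) > 0"
    proof -
      have "s \<noteq> v" "s \<noteq> w" using s v(1) w(1) by auto
      hence "s < v \<or> w < s" using none s by (meson linorder_neqE_linordered_idom)
      thus ?thesis
      proof
        assume "s < v"
        thus ?thesis using vw by (intro mult_pos_pos) auto
      next
        assume "w < s"
        thus ?thesis using vw by (intro mult_neg_neg) auto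
      qed
    qed
    moreover have "c s / (v - s) - c s / (w - s) = c s * (w - v) / ((v - s) * (w - s))"
    proof -
      have "v - s \<noteq> 0" "w - s \<noteq> 0" using s v(1) w(1) by auto
      thus ?thesis by (simp add: diff_frac_eq mult.commute flip: right_diff_distrib)
    qed
    ultimately have "c s / (v - s) - c s / (w - s) > 0" using bspec[OF c s] vw by simp
    thus ?thesis by simp
  qed
  hence "(\<Sum>s\<in>S. c s / (w - s)) < (\<Sum>s\<in>S. c s / (v - s))" using S by (intro sum_strict_mono) auto
  thus False using v w by simp
qed

text \<open>Left of all poles every term is negative, right of all poles every term is
  positive.\<close>

lemma partial_fraction_zero_between:
  fixes c :: "real \<Rightarrow> real"
  assumes S: "finite S" "S \<noteq> {}" and c: "\<forall>s\<in>S. c s > 0"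
    and w: "w \<notin> S" "(\<Sum>s\<in>S. c s / (w - s)) = 0"
  shows "\<exists>s\<in>S. s < w" "\<exists>s\<in>S. w < s"
proof -
  show "\<exists>s\<in>S. s < w"
  proof (rule ccontr)
    assume "\<not> ?thesis"
    hence "(\<Sum>s\<in>S. c s / (w - s)) < (\<Sum>s\<in>S. 0)"
      using S c w(1) by (intro sum_strict_mono) (force intro!: divide_pos_neg)+
    thus False using w by simp
  qed
  show "\<exists>s\<in>S. w < s"
  proof (rule ccontr)
    assume "\<not> ?thesis"
    hence "(\<Sum>s\<in>S. 0) < (\<Sum>s\<in>S. c s / (w - s))"
      using S c w(1) by (intro sum_strict_mono) (force intro!: divide_pos_pos)+
    thus False using w by simp
  qed
qed

text \<open>One notion for both directions, open or closed, so that the counting lemma serves a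
  half-line, its complement and its mirror image.\<close>

definition real_ray :: "real set \<Rightarrow> bool" where
  "real_ray A \<longleftrightarrow> (\<forall>x\<in>A. \<forall>y\<le>x. y \<in> A) \<or> (\<forall>x\<in>A. \<forall>y\<ge>x. y \<in> A)"

text \<open>Send each zero to the nearest pole on the side where the ray extends: the pole stays in
  \<open>A\<close>, and since poles separate zeros, the map is injective.\<close>

lemma card_partial_fraction_zeros_le:
  fixes c :: "real \<Rightarrow> real"
  assumes S: "finite S" "S \<noteq> {}" and c: "\<forall>s\<in>S. c s > 0" and A: "real_ray A"
    and Z: "\<And>w. w \<in> Z \<Longrightarrow> w \<in> A \<and> w \<notin> S \<and> (\<Sum>s\<in>S. c s / (w - s)) = 0"
  shows "card Z \<le> card (S \<inter> A)"
  using A unfolding real_ray_def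
proof
  assume down: "\<forall>x\<in>A. \<forall>y\<le>x. y \<in> A"
  define \<phi> where "\<phi> w = Max {s\<in>S. s < w}" for w
  have \<phi>: "\<phi> w \<in> S \<and> \<phi> w < w" if "w \<in> Z" for w
  proof -
    have "{s\<in>S. s < w} \<noteq> {}" using partial_fraction_zero_between(1)[OF S c] Z[OF that] by blast
    thus ?thesis using Max_in[of "{s\<in>S. s < w}"] S by (simp add: \<phi>_def)
  qed
  have lt: "\<phi> v < \<phi> w" if vw: "v \<in> Z" "w \<in> Z" "v < w" for v w
  proof -
    obtain s where s: "s \<in> S" "v < s" "s < w"
      using partial_fraction_zeros_separated[OF S c, of v w] Z vw by blast
    hence "s \<le> \<phi> w" unfolding \<phi>_def using S by (intro Max_ge) auto
    thus ?thesis using \<phi>[OF vw(1)] s by linarith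
  qed
  have "inj_on \<phi> Z" by (rule linorder_inj_onI) (use lt in \<open>force+\<close>)
  moreover have "\<phi> ` Z \<subseteq> S \<inter> A" using \<phi> Z down by (meson IntI image_subsetI less_imp_le)
  ultimately show ?thesis using S by (intro card_inj_on_le) auto
next
  assume up: "\<forall>x\<in>A. \<forall>y\<ge>x. y \<in> A"
  define \<phi> where "\<phi> w = Min {s\<in>S. w < s}" for w
  have \<phi>: "\<phi> w \<in> S \<and> w < \<phi> w" if "w \<in> Z" for w
  proof -
    have "{s\<in>S. w < s} \<noteq> {}" using partial_fraction_zero_between(2)[OF S c] Z[OF that] by blast
    thus ?thesis using Min_in[of "{s\<in>S. w < s}"] S by (simp add: \<phi>_def)
  qed
  have lt: "\<phi> v < \<phi> w" if vw: "v \<in> Z" "w \<in> Z" "v < w" for v w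
  proof -
    obtain s where s: "s \<in> S" "v < s" "s < w"
      using partial_fraction_zeros_separated[OF S c, of v w] Z vw by blast
    hence "\<phi> v \<le> s" unfolding \<phi>_def using S by (intro Min_le) auto
    thus ?thesis using \<phi>[OF vw(2)] s by linarith
  qed
  have "inj_on \<phi> Z" by (rule linorder_inj_onI) (use lt in \<open>force+\<close>)
  moreover have "\<phi> ` Z \<subseteq> S \<inter> A" using \<phi> Z up by (meson IntI image_subsetI less_imp_le)
  ultimately show ?thesis using S by (intro card_inj_on_le) auto
qed

lemma interlacing_root_count:
  assumes "interlacing F W" "real_ray A"
  shows "root_count W A \<le> root_count F A"
proof -
  obtain H S c where S: "finite S" "S \<noteq> {}" and H: "H \<noteq> 0" and c: "\<forall>s\<in>S. c s > 0"
    and eq: "F = H * nodal_poly S" "W = H * residue_poly S c"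
    using assms(1) unfolding interlacing_def by blast
  have nz: "residue_poly S c \<noteq> 0" using residue_poly_nz[OF S c] .
  have "root_count (residue_poly S c) A = card {x\<in>A. poly (residue_poly S c) (of_real x) = 0}"
    by (intro root_count_squarefree nz order_residue_poly_le S c)
  also have "\<dots> \<le> card (S \<inter> A)"
  proof (rule card_partial_fraction_zeros_le[OF S c assms(2)])
    fix w assume "w \<in> {x\<in>A. poly (residue_poly S c) (of_real x) = 0}"
    hence w: "w \<in> A" "poly (residue_poly S c) (of_real w) = 0" by auto
    have "w \<notin> S" "(\<Sum>s\<in>S. c s / (w - s)) = 0"
      by (rule residue_poly_root[OF S(1) c w(2)])+
    thus "w \<in> A \<and> w \<notin> S \<and> (\<Sum>s\<in>S. c s / (w - s)) = 0" using w(1) by blast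
  qed
  finally show ?thesis
    unfolding eq using S H nz by (simp add: root_count_mult root_count_nodal_poly)
qed

lemma interlacing_order_le:
  assumes "interlacing F W"
  shows "order (of_real x) W \<le> Suc (order (of_real x) F)"
proof -
  obtain H S c where S: "finite S" "S \<noteq> {}" and H: "H \<noteq> 0" and c: "\<forall>s\<in>S. c s > 0"
    and eq: "F = H * nodal_poly S" "W = H * residue_poly S c"
    using assms unfolding interlacing_def by blast
  have nz: "residue_poly S c \<noteq> 0" using residue_poly_nz[OF S c] .
  show ?thesis unfolding eq using H nz order_residue_poly_le[OF S c, of x] by (simp add: order_mult)
qed

lemma Pd_linear_mult:
  assumes "u \<in> Pd d K" "\<nu> \<in> K"
  shows "[:-\<nu>, 1:] * u \<in> Pd (Suc d) K"
proof -
  have "degree ([:-\<nu>, 1:] * u) = Suc d" using assms by (subst degree_mult_eq) (auto simp: PdD)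
  moreover have "lead_coeff ([:-\<nu>, 1:] * u) = 1" using assms by (subst lead_coeff_mult) (auto simp: PdD)
  moreover have "z \<in> K" if "poly ([:-\<nu>, 1:] * u) z = 0" for z
  proof -
    have "(z - \<nu>) * poly u z = 0" using that by (simp add: algebra_simps)
    thus ?thesis using assms PdD(4)[OF assms(1)] by auto
  qed
  ultimately show ?thesis unfolding Pd_def by blast
qed

lemma interlacing_pderiv:
  assumes "q \<in> Pd (Suc d) \<real>"
  shows "interlacing q (pderiv q)"
  using PdD(1)[OF assms] assms
  by (intro anti_nevanlinna_imp_interlacing[OF anti_nevanlinna_pderiv[OF assms] assms])
     (auto simp: pderiv_eq_0_iff degree_pderiv)

lemma interlacing_ffconv:
  assumes u: "u \<in> Pd d \<real>" and \<nu>: "\<nu> \<in> \<real>" and q: "q \<in> Pd (Suc d) \<real>"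
  shows "interlacing (ffconv (Suc d) ([:-\<nu>, 1:] * u) q) (ffconv (Suc d) u q)"
proof -
  have "ffconv (Suc d) u q \<in> Pd d \<real>"
    unfolding ffconv_monic_pderiv[OF u q]
    by (intro ffconv_real_rooted u monic_pderiv_real_rooted q)
  thus ?thesis
    by (intro anti_nevanlinna_imp_interlacing[OF anti_nevanlinna_ffconv[OF u \<nu> q]
          ffconv_real_rooted[OF Pd_linear_mult[OF u \<nu>] q]]) (auto simp: PdD)
qed

section \<open>The Weyl-type inequality\<close>

lemma real_ray_half_line:
  fixes \<omega> t :: real
  assumes "\<omega> = 1 \<or> \<omega> = -1"
  shows "real_ray {x. \<omega> * x \<le> t}" "real_ray (- {x. \<omega> * x \<le> t})"
  using assms by (auto simp: real_ray_def)

lemma root_count_full: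
  assumes "p \<in> Pd d \<real>" "\<And>x::real. poly p (of_real x) = 0 \<Longrightarrow> x \<in> A"
  shows "root_count p A = d"
proof -
  have "filter_mset (\<lambda>z. z \<in> of_real ` (- A)) (proots p) = {#}"
    using assms by (subst set_mset_eq_empty_iff[symmetric]) (auto simp: PdD)
  hence "root_count p (- A) = 0" unfolding root_count_def by (simp only: size_empty)
  thus ?thesis using root_count_Compl[OF assms(1), of A] by simp
qed

text \<open>Interlacing on the complement bounds the count of the derivative there; as the total
  drops by one, at most one root in \<open>A\<close> is lost.\<close>

lemma root_count_monic_pderiv_ge:
  assumes q: "q \<in> Pd (Suc d) \<real>" and A: "real_ray (- A)"
  shows "root_count q A \<le> Suc (root_count (monic_pderiv q) A)"
proof -
  have "root_count (monic_pderiv q) (- A) = root_count (pderiv q) (- A)"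
    using q by (simp add: root_count_def monic_pderiv_def PdD del: of_nat_Suc)
  also have "\<dots> \<le> root_count q (- A)"
    using interlacing_root_count[OF interlacing_pderiv[OF q] A] .
  finally show ?thesis
    using root_count_Compl[OF q, of A] root_count_Compl[OF monic_pderiv_real_rooted[OF q], of A] by linarith
qed

text \<open>Roots of \<open>p\<close> beyond \<open>s\<close> are sent to infinity one at a time, which replaces the
  convolution by an interlacing polynomial of one degree less.\<close>
lemma root_count_ffconv_ge:
  fixes \<omega> s t :: real
  assumes \<omega>: "\<omega> = 1 \<or> \<omega> = -1" and "p \<in> Pd d \<real>" "q \<in> Pd d \<real>"
  shows "root_count p {x. \<omega> * x \<le> s} + root_count q {x. \<omega> * x \<le> t} \<le>
    d + root_count (ffconv d p q) {x. \<omega> * x \<le> s + t}"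
  using assms(2,3)
proof (induction d arbitrary: p q s t)
  case 0
  thus ?case using root_count_Compl[OF 0(1), of "{x. \<omega> * x \<le> s}"] root_count_Compl[OF 0(2), of "{x. \<omega> * x \<le> t}"] by simp
next
  case (Suc d)
  note ray = real_ray_half_line[OF \<omega>]
  \<comment> \<open>The root \<open>l\<close> is not counted in \<open>p\<close>. Removing it
    replaces \<open>q\<close> by its derivative, whose count drops by at most one, matching the drop
    from \<open>Suc d\<close> to \<open>d\<close>; interlacing leads back to the original
    convolution.\<close>
  have step: "root_count p {x. \<omega> * x \<le> s} + root_count q {x. \<omega> * x \<le> t} \<le>
      Suc d + root_count (ffconv (Suc d) p q) {x. \<omega> * x \<le> s + t}"
    if p: "p \<in> Pd (Suc d) \<real>" and q: "q \<in> Pd (Suc d) \<real>" and l: "poly p (of_real l) = 0" "\<omega> * l > s"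
    for p q s t and l :: real
  proof -
    obtain u where u: "p = [:- of_real l, 1:] * u" "u \<in> Pd d \<real>" using Pd_Suc_factor[OF p l(1)] .
    have "root_count p {x. \<omega> * x \<le> s} = root_count u {x. \<omega> * x \<le> s}"
      using u l by (simp add: root_count_mult root_count_linear PdD del: mult_pCons_left)
    moreover have "root_count u {x. \<omega> * x \<le> s} + root_count (monic_pderiv q) {x. \<omega> * x \<le> t} \<le>
        d + root_count (ffconv d u (monic_pderiv q)) {x. \<omega> * x \<le> s + t}"
      by (intro Suc.IH u monic_pderiv_real_rooted q)
    moreover have "root_count (ffconv (Suc d) u q) {x. \<omega> * x \<le> s + t} \<le> root_count (ffconv (Suc d) p q) {x. \<omega> * x \<le> s + t}"
      unfolding u by (intro interlacing_root_count interlacing_ffconv u q ray) auto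
    ultimately show ?thesis
      using root_count_monic_pderiv_ge[OF q ray(2), of t] ffconv_monic_pderiv[OF u(2) q] by simp
  qed
  show ?case
  proof (cases "\<exists>l::real. poly p (of_real l) = 0 \<and> \<omega> * l > s")
    case True
    thus ?thesis using step Suc.prems by blast
  next
    case p_le: False
    show ?thesis
    proof (cases "\<exists>l::real. poly q (of_real l) = 0 \<and> \<omega> * l > t")
      case True
      then obtain l where "poly q (of_real l) = 0" "\<omega> * l > t" by blast
      from step[OF Suc.prems(2,1) this, of s] show ?thesis by (simp add: ffconv_commute[of _ q] add_ac)
    next
      case q_le: False
      \<comment> \<open>With no root beyond either threshold, Grace's theorem puts all
        \<open>Suc d\<close> roots of the convolution into the half-line.\<close>
      have half: "r \<in> Pd (Suc d) {z. Re (of_real \<omega> * z) \<le> b}"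
        if "r \<in> Pd (Suc d) \<real>" "\<not> (\<exists>l::real. poly r (of_real l) = 0 \<and> \<omega> * l > b)" for r b
        using that by (force simp: Pd_def elim!: Reals_cases)
      have F: "ffconv (Suc d) p q \<in> Pd (Suc d) \<real>" using Suc.prems by (rule ffconv_real_rooted)
      have "root_count (ffconv (Suc d) p q) {x. \<omega> * x \<le> s + t} = Suc d"
        using ffconv_half_plane[OF half[OF Suc.prems(1) p_le] half[OF Suc.prems(2) q_le]]
        by (intro root_count_full[OF F]) fastforce
      moreover have "root_count p {x. \<omega> * x \<le> s} \<le> Suc d" "root_count q {x. \<omega> * x \<le> t} \<le> Suc d"
        using root_count_Compl Suc.prems by (metis le_add1)+
      ultimately show ?thesis by simp
    qed
  qed
qed

text \<open>Interlacing bounds the order of the derivative by one more than that of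
  \<open>q\<close>, so a multiple root of the derivative is a root of \<open>q\<close>.\<close>

lemma order_monic_pderiv:
  assumes q: "q \<in> Pd (Suc d) \<real>" and ord: "order \<beta> (monic_pderiv q) \<ge> 2"
  shows "order \<beta> q = Suc (order \<beta> (monic_pderiv q))"
proof -
  have eq: "order \<beta> (monic_pderiv q) = order \<beta> (pderiv q)"
    using q by (simp add: monic_pderiv_def PdD order_smult del: of_nat_Suc)
  have "poly (monic_pderiv q) \<beta> = 0" using ord order_0I[of "monic_pderiv q" \<beta>] by fastforce
  hence "\<beta> \<in> \<real>" using PdD(4)[OF monic_pderiv_real_rooted[OF q]] by blast
  then obtain b where b: "\<beta> = of_real b" by (auto elim: Reals_cases)
  have "order \<beta> q \<noteq> 0" using interlacing_order_le[OF interlacing_pderiv[OF q], of b] ord eq b by simp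
  hence "poly q \<beta> = 0" by (simp add: order_root)
  thus ?thesis unfolding eq using order_pderiv PdD(3)[OF q] by blast
qed

lemma order_ge_2I:
  fixes p :: "'a :: field_char_0 poly"
  assumes "p \<noteq> 0" "poly p x = 0" "poly (pderiv p) x = 0"
  shows "order x p \<ge> 2"
proof -
  have "pderiv p \<noteq> 0" using assms by (metis pderiv_iszero poly_const_conv pCons_0_0)
  thus ?thesis using order_pderiv[OF assms(1,2)] order_gt_0_iff[of "pderiv p" x] assms by simp
qed

lemma poly_real_rooted_in_Reals:
  assumes "p \<in> Pd d \<real>" "x \<in> \<real>"
  shows "poly p x \<in> \<real>"
proof -
  obtain r where "p = (\<Prod>i<d. [:- r i, 1:])" "\<And>i. i < d \<Longrightarrow> r i \<in> \<real>"
    using monic_complex_poly_factors[OF assms(1)] by blast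
  thus ?thesis using assms by (auto simp: poly_prod intro!: prod_in_Reals Reals_diff)
qed

lemma poly_pderiv_real_rooted_in_Reals:
  assumes "p \<in> Pd d \<real>" "x \<in> \<real>"
  shows "poly (pderiv p) x \<in> \<real>"
proof (cases d)
  case 0
  hence "pderiv p = 0" using assms by (simp add: pderiv_eq_0_iff PdD)
  thus ?thesis by simp
next
  case (Suc e)
  have "poly (pderiv p) x = of_nat d * poly (monic_pderiv p) x"
    using assms Suc by (simp add: monic_pderiv_def PdD del: of_nat_Suc)
  thus ?thesis using poly_real_rooted_in_Reals[OF monic_pderiv_real_rooted, of p e x] assms Suc
    by (metis Reals_mult Reals_of_nat)
qed

section \<open>Multiple roots and atoms\<close>

text \<open>If \<open>p\<close> has two distinct roots \<open>\<nu>\<close>, \<open>\<mu>\<close>, write \<open>p = (x - \<nu>) (x - \<mu>) h\<close>. Interlacing forces all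
  the convolutions \<open>(x - c) h \<boxplus> q\<close> to vanish at the multiple root, and a suitable choice
  of \<open>c\<close> produces a multiple root again, of a convolution of smaller degree.\<close>
lemma multiple_root_ffconv:
  assumes "p \<in> Pd d \<real>" "q \<in> Pd d \<real>" "order x (ffconv d p q) \<ge> 2"
  shows "\<exists>\<alpha> \<beta>. order \<alpha> p + order \<beta> q > d \<and> x = \<alpha> + \<beta>"
  using assms
proof (induction d arbitrary: p q rule: less_induct)
  case (less d)
  note p = less.prems(1) and q = less.prems(2)
  note F = ffconv_real_rooted[OF p q]
  have x0: "poly (ffconv d p q) x = 0" using less.prems(3) order_0I[of "ffconv d p q" x] by fastforce
  hence xR: "x \<in> \<real>" using PdD(4)[OF F] by blast
  then obtain x' where x': "x = of_real x'" by (auto elim: Reals_cases)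
  have "2 \<le> d" using less.prems(3) order_degree[of "ffconv d p q" x] F by (simp add: PdD)
  then obtain f where f: "d = Suc (Suc f)" by (metis One_nat_def Suc_1 Suc_le_D Suc_le_mono)
  obtain \<nu> where \<nu>: "poly p \<nu> = 0" "\<nu> \<in> \<real>" using Pd_root_exists[of p "Suc f" \<real>] p f by auto
  show ?case
  proof (cases "\<exists>\<mu>. poly p \<mu> = 0 \<and> \<mu> \<noteq> \<nu>")
    \<comment> \<open>Here \<open>p\<close> is the \<open>d\<close>-th power of
      \<open>x - \<nu>\<close> and the convolution is \<open>q\<close> translated by
      \<open>\<nu>\<close>.\<close>
    case False
    hence "p \<in> Pd d {\<nu>}" using p by (auto simp: Pd_def)
    then obtain r where r: "p = (\<Prod>i<d. [:- r i, 1:])" "\<And>i. i < d \<Longrightarrow> r i \<in> {\<nu>}"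
      using monic_complex_poly_factors by blast
    hence "p = [:- \<nu>, 1:] ^ d" by simp
    hence ord: "order \<nu> p = d" by (simp add: order_power_n_n del: power_Suc)
    have "poly (ffconv d p q) (\<nu> + (x - \<nu>)) =
        (\<Sum>k\<le>d. poly ((pderiv ^^ k) p) \<nu> * poly ((pderiv ^^ (d - k)) q) (x - \<nu>)) / fact d"
      using p q by (intro poly_ffconv) (auto simp: PdD)
    also have "(\<Sum>k\<le>d. poly ((pderiv ^^ k) p) \<nu> * poly ((pderiv ^^ (d - k)) q) (x - \<nu>)) =
        (\<Sum>k\<in>{d}. poly ((pderiv ^^ k) p) \<nu> * poly ((pderiv ^^ (d - k)) q) (x - \<nu>))"
      using poly_higher_pderiv_less_order[of p _ \<nu>] p ord by (intro sum.mono_neutral_right) (auto simp: PdD)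
    finally have "poly q (x - \<nu>) = 0"
      using x0 poly_higher_pderiv_order[of p \<nu>] p ord by (simp add: PdD)
    hence "order (x - \<nu>) q > 0" using q by (simp add: order_gt_0_iff PdD)
    thus ?thesis using ord by (intro exI[of _ \<nu>] exI[of _ "x - \<nu>"]) auto
  next
    case True
    then obtain \<mu> where \<mu>: "poly p \<mu> = 0" "\<mu> \<noteq> \<nu>" by blast
    have \<mu>R: "\<mu> \<in> \<real>" using PdD(4)[OF p \<mu>(1)] .
    obtain u where u: "p = [:-\<nu>, 1:] * u" "u \<in> Pd (Suc f) \<real>"
      using Pd_Suc_factor \<nu>(1) p f by blast
    have "poly p \<mu> = (\<mu> - \<nu>) * poly u \<mu>" unfolding u by (simp add: algebra_simps)
    hence "poly u \<mu> = 0" using \<mu> by simp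
    then obtain h where h: "u = [:-\<mu>, 1:] * h" "h \<in> Pd f \<real>"
      using Pd_Suc_factor u(2) by blast
    define q1 q2 where "q1 = monic_pderiv q" and "q2 = monic_pderiv q1"
    have q1: "q1 \<in> Pd (Suc f) \<real>" unfolding q1_def using q f monic_pderiv_real_rooted by blast
    have q2: "q2 \<in> Pd f \<real>" unfolding q2_def using q1 monic_pderiv_real_rooted by blast
    define N where "N c = ffconv (Suc f) ([:-c, 1:] * h) q1" for c
    define W where "W = ffconv (Suc f) h q1"
    have W: "W = ffconv f h q2" unfolding W_def q2_def by (rule ffconv_monic_pderiv[OF h(2) q1])
    have WP: "W \<in> Pd f \<real>" unfolding W by (intro ffconv_real_rooted h q2)
    have NP: "N c \<in> Pd (Suc f) \<real>" if "c \<in> \<real>" for c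
      unfolding N_def by (intro ffconv_real_rooted Pd_linear_mult h q1 that)
    have Neq: "N c = N \<nu> - smult (c - \<nu>) W" for c
      unfolding N_def W_def by (rule ffconv_linear_mult_eq)
    \<comment> \<open>Removing the root \<open>l\<close> of \<open>p\<close> lowers the order of the
      convolution at \<open>x\<close> by at most one.\<close>
    have vanish: "poly (ffconv (Suc f) v q1) x = 0" if v: "p = [:-l, 1:] * v" "v \<in> Pd (Suc f) \<real>" and l: "l \<in> \<real>" for v l
    proof -
      have "order (of_real x') (ffconv d p q) \<le> Suc (order (of_real x') (ffconv d v q))"
      proof (rule anti_nevanlinna_order)
        show "anti_nevanlinna (ffconv d p q) (ffconv d v q)"
          unfolding v(1) f using v(2) l q f by (intro anti_nevanlinna_ffconv) auto
        show "ffconv d p q \<noteq> 0" using F by (rule PdD)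
        show "ffconv d v q \<noteq> 0"
          using ffconv_real_rooted[OF v(2) q1] ffconv_monic_pderiv[OF v(2), of q] q f by (auto simp: q1_def PdD)
      qed
      hence "order x (ffconv (Suc f) v q1) \<noteq> 0"
        using less.prems(3) ffconv_monic_pderiv[OF v(2), of q] q f by (simp add: x' q1_def)
      thus ?thesis by (simp add: order_root)
    qed
    have N\<mu>: "poly (N \<mu>) x = 0"
      unfolding N_def h(1)[symmetric] using vanish[OF u \<nu>(2)] .
    have N\<nu>: "poly (N \<nu>) x = 0"
      unfolding N_def
    proof (rule vanish)
      show "p = [:-\<mu>, 1:] * ([:-\<nu>, 1:] * h)" unfolding u h by (rule mult.left_commute)
    qed (intro Pd_linear_mult h \<nu> \<mu>R)+
    \<comment> \<open>\<open>N \<mu>\<close> and \<open>N \<nu>\<close> differ by a nonzero multiple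
      of \<open>W\<close>.\<close>
    have Wx: "poly W x = 0" using N\<mu> N\<nu> \<mu>(2) unfolding Neq[of \<mu>] by simp
    have h0: "h \<noteq> 0" using h by (simp add: PdD)
    have hp: "order \<alpha> h \<le> order \<alpha> p" for \<alpha>
      using PdD(3)[OF p] unfolding u h by (intro dvd_imp_order_le dvd_mult dvd_refl)
    show ?thesis
    proof (cases "poly (pderiv W) x = 0")
      case True
      hence ord: "order x (ffconv f h q2) \<ge> 2" using order_ge_2I[of W x] Wx WP W by (simp add: PdD)
      obtain \<alpha> \<beta> where ab: "order \<alpha> h + order \<beta> q2 > f" "x = \<alpha> + \<beta>"
        using less.IH[OF _ h(2) q2 ord] f by auto
      \<comment> \<open>The order formula sharpens the excess to 2. Since \<open>h\<close> accounts
        for at most \<open>f\<close>, \<open>\<beta>\<close> is a multiple root of \<open>q2\<close>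
        and gains one order at each of the two steps back to \<open>q\<close>.\<close>
      have "order \<alpha> h + order \<beta> q2 \<ge> f + 2"
        using order_ffconv[OF h(2) q2, of \<alpha> \<beta>] ab ord by simp
      moreover have "order \<alpha> h \<le> f" using order_degree[OF h0, of \<alpha>] h by (simp add: PdD)
      ultimately have "order \<beta> q2 \<ge> 2" by simp
      hence "order \<beta> q1 = Suc (order \<beta> q2)" using order_monic_pderiv[OF q1] by (simp add: q2_def)
      moreover from this have "order \<beta> q = Suc (order \<beta> q1)"
        using order_monic_pderiv[of q "Suc f" \<beta>] q f \<open>order \<beta> q2 \<ge> 2\<close> by (simp add: q1_def)
      ultimately have "order \<alpha> p + order \<beta> q > d"
        using hp[of \<alpha>] \<open>order \<alpha> h + order \<beta> q2 \<ge> f + 2\<close> f by simp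
      thus ?thesis using ab by blast
    next
      case False
      \<comment> \<open>The member of the pencil whose derivative vanishes at \<open>x\<close>; all
        members vanish there, because \<open>N \<nu>\<close> and \<open>W\<close> do.\<close>
      define c where "c = \<nu> + poly (pderiv (N \<nu>)) x / poly (pderiv W) x"
      have cR: "c \<in> \<real>" unfolding c_def
        by (intro Reals_add Reals_divide \<nu> poly_pderiv_real_rooted_in_Reals[OF NP] poly_pderiv_real_rooted_in_Reals[OF WP] xR)
      have "poly (pderiv (N c)) x = 0" "poly (N c) x = 0"
        unfolding Neq[of c] using False N\<nu> Wx by (simp_all add: pderiv_diff pderiv_smult c_def)
      hence ord: "order x (ffconv (Suc f) ([:-c, 1:] * h) q1) \<ge> 2"
        using order_ge_2I[of "N c" x] NP[OF cR] by (simp add: PdD N_def)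
      have hc: "[:-c, 1:] * h \<in> Pd (Suc f) \<real>" by (intro Pd_linear_mult h cR)
      obtain \<alpha> \<beta> where ab: "order \<alpha> ([:-c, 1:] * h) + order \<beta> q1 > Suc f" "x = \<alpha> + \<beta>"
        using less.IH[OF _ hc q1 ord] f by auto
      have sum: "order \<alpha> ([:-c, 1:] * h) + order \<beta> q1 \<ge> Suc f + 2"
        using order_ffconv[OF hc q1, of \<alpha> \<beta>] ab ord by simp
      have "order \<alpha> ([:-c, 1:] * h) \<le> Suc f"
        using order_degree[OF PdD(3)[OF hc], of \<alpha>] unfolding PdD(1)[OF hc] .
      hence "order \<beta> q1 \<ge> 2" using sum by simp
      hence "order \<beta> q = Suc (order \<beta> q1)"
        using order_monic_pderiv[of q "Suc f" \<beta>] q f by (simp add: q1_def)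
      \<comment> \<open>The auxiliary root \<open>c\<close> may add one order at
        \<open>\<alpha>\<close>; the order gained from \<open>q1\<close> to \<open>q\<close>
        compensates, so the total is at least \<open>f + 3 = d + 1\<close>.\<close>
      moreover have "order \<alpha> ([:-c, 1:] * h) \<le> 1 + order \<alpha> p"
      proof -
        have "order \<alpha> [:-c, 1:] \<le> 1" using order_degree[of "[:-c, 1:]" \<alpha>] by simp
        thus ?thesis using hp[of \<alpha>] unfolding order_mult[OF PdD(3)[OF hc]] by linarith
      qed
      ultimately have "order \<alpha> p + order \<beta> q > d" using sum f by simp
      thus ?thesis using ab by blast
    qed
  qed
qed

section \<open>Root counts as measures and distribution functions\<close>

lemma root_measure_of_real_image:
  assumes "p \<noteq> 0"
  shows "root_measure d p (of_real ` A) = real (root_count p A) / real d"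
proof -
  have "{r. poly p r = 0 \<and> r \<in> of_real ` A} = set_mset (filter_mset (\<lambda>z. z \<in> of_real ` A) (proots p))"
    using assms by auto
  moreover have "(\<Sum>r\<in>set_mset (filter_mset (\<lambda>z. z \<in> of_real ` A) (proots p)). order r p) = root_count p A"
    using assms unfolding root_count_def size_multiset_overloaded_eq by (intro sum.cong) auto
  ultimately show ?thesis
    unfolding root_measure_def by (simp add: sum_divide_distrib[symmetric] flip: of_nat_sum)
qed

lemma root_cdf_eq_root_count:
  assumes "p \<noteq> 0"
  shows "root_cdf d p x = real (root_count p {..x}) / real d"
proof -
  have "{z. z \<in> \<real> \<and> Re z \<le> x} = of_real ` {..x}" by (auto elim!: Reals_cases)
  thus ?thesis using root_measure_of_real_image[OF assms] by (simp add: root_cdf_def)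
qed

lemma root_measure_singleton:
  assumes "p \<noteq> 0"
  shows "root_measure d p {a} = real (order a p) / real d"
proof -
  have "{r. poly p r = 0 \<and> r \<in> {a}} = (if poly p a = 0 then {a} else {})" by auto
  thus ?thesis by (simp add: root_measure_def order_0I)
qed

lemma root_count_half_lines:
  assumes p: "p \<in> Pd d \<real>"
  shows "root_count p {..s} + root_count p {s..} = d + order (of_real s) p"
proof -
  have "filter_mset (\<lambda>z. z \<in> of_real ` {s..}) (proots p) =
      filter_mset (\<lambda>z. z \<in> of_real ` (- {..s})) (proots p) + replicate_mset (order (of_real s) p) (of_real s)"
    using p by (intro multiset_eqI) (auto simp: PdD less_le)
  hence "root_count p {s..} = root_count p (- {..s}) + order (of_real s) p"
    by (simp add: root_count_def)
  thus ?thesis using root_count_Compl[OF p, of "{..s}"] by simp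
qed

text \<open>Left and right closed half-lines overlap in one point, so by the order formula both
  sides of the two Weyl-type inequalities have the same total; hence both are equalities.\<close>

lemma root_count_ffconv_atom:
  fixes s t :: real
  assumes p: "p \<in> Pd d \<real>" and q: "q \<in> Pd d \<real>" and d: "d \<le> order (of_real s) p + order (of_real t) q"
  shows "root_count p {..s} + root_count q {..t} = d + root_count (ffconv d p q) {..s + t}"
proof -
  have le: "{x. 1 * x \<le> a} = {..a}" and ge: "{x. - 1 * x \<le> - a} = {a..}" for a :: real by auto
  have ge': "{x. - 1 * x \<le> - s + - t} = {s + t..}" by auto
  have "root_count p {..s} + root_count q {..t} \<le> d + root_count (ffconv d p q) {..s + t}"
    using root_count_ffconv_ge[of 1 p d q s t] p q unfolding le by simp
  moreover have "root_count p {s..} + root_count q {t..} \<le> d + root_count (ffconv d p q) {s + t..}"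
    using root_count_ffconv_ge[of "-1" p d q "-s" "-t"] p q unfolding ge ge' by simp
  ultimately show ?thesis
    using root_count_half_lines[OF p, of s] root_count_half_lines[OF q, of t]
      root_count_half_lines[OF ffconv_real_rooted[OF p q], of "s + t"] order_ffconv[OF p q d] d
    by simp
qed

theorem theorem1p1:
  fixes d :: nat and p q :: "complex poly"
  assumes "p \<in> Pd d \<real>" and "q \<in> Pd d \<real>"
  shows "(\<forall>r. poly (ffconv d p q) r = 0 \<and> \<not> trivial_root d p q r
            \<longrightarrow> order r (ffconv d p q) = 1)
       \<and> (\<forall>\<alpha> \<beta>. atom_triplet d p q \<alpha> \<beta> \<longrightarrow>
            root_measure d (ffconv d p q) {\<alpha> + \<beta>} = root_measure d p {\<alpha>} + root_measure d q {\<beta>} - 1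
          \<and> root_cdf d (ffconv d p q) (Re (\<alpha> + \<beta>)) = root_cdf d p (Re \<alpha>) + root_cdf d q (Re \<beta>) - 1)"
proof (intro conjI allI impI; (elim conjE)?)
  let ?F = "ffconv d p q"
  have nz: "p \<noteq> 0" "q \<noteq> 0" "?F \<noteq> 0"
    using assms ffconv_real_rooted[OF assms] by (auto simp: PdD)
  {
    fix r assume r: "poly ?F r = 0" "\<not> trivial_root d p q r"
    have "\<not> order r ?F \<ge> 2"
    proof
      assume "order r ?F \<ge> 2"
      then obtain \<alpha> \<beta> where ab: "order \<alpha> p + order \<beta> q > d" "r = \<alpha> + \<beta>"
        using multiple_root_ffconv assms by blast
      \<comment> \<open>Neither order exceeds \<open>d\<close>, so a sum above \<open>d\<close>
        makes both positive: \<open>\<alpha>\<close> and \<open>\<beta>\<close> are roots.\<close>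
      have "order \<alpha> p \<le> d" "order \<beta> q \<le> d" 
        using order_degree[OF nz(1), of \<alpha>] order_degree[OF nz(2), of \<beta>] assms by (auto simp: PdD)
      hence "poly p \<alpha> = 0" "poly q \<beta> = 0" using ab order_0I[of p \<alpha>] order_0I[of q \<beta>] by fastforce+
      moreover have "int (order \<alpha> p) + int (order \<beta> q) - int d > 0" using ab(1) by linarith
      ultimately show False using ab(2) r(2) unfolding trivial_root_def atom_triplet_def by blast
    qed
    moreover have "order r ?F > 0" using r nz by (simp add: order_gt_0_iff)
    ultimately show "order r ?F = 1" by simp
  }
  fix \<alpha> \<beta> assume atom: "atom_triplet d p q \<alpha> \<beta>"
  hence d: "d < order \<alpha> p + order \<beta> q" by (simp add: atom_triplet_def)
  \<comment> \<open>In degree 0 all orders are 0; positivity of \<open>d\<close> makes the divisions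
    by \<open>d\<close> meaningful.\<close>
  have "d > 0" using d order_degree[OF nz(1), of \<alpha>] order_degree[OF nz(2), of \<beta>] assms by (auto simp: PdD)
  have "order (\<alpha> + \<beta>) ?F = order \<alpha> p + order \<beta> q - d"
    using order_ffconv[OF assms] d by simp
  thus "root_measure d ?F {\<alpha> + \<beta>} = root_measure d p {\<alpha>} + root_measure d q {\<beta>} - 1"
    using nz d \<open>d > 0\<close> by (simp add: root_measure_singleton field_simps of_nat_diff)
  have "\<alpha> \<in> \<real>" "\<beta> \<in> \<real>"
    using atom PdD(4)[OF assms(1)] PdD(4)[OF assms(2)] by (auto simp: atom_triplet_def)
  then obtain s t where st: "\<alpha> = of_real s" "\<beta> = of_real t" by (auto elim!: Reals_cases)
  have "root_count p {..s} + root_count q {..t} = d + root_count ?F {..s + t}"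
    using root_count_ffconv_atom[OF assms, of s t] d st by simp
  hence "real (root_count p {..s}) + real (root_count q {..t}) = real d + real (root_count ?F {..s + t})"
    by (metis of_nat_add)
  thus "root_cdf d ?F (Re (\<alpha> + \<beta>)) = root_cdf d p (Re \<alpha>) + root_cdf d q (Re \<beta>) - 1"
    using nz \<open>d > 0\<close> by (simp add: st root_cdf_eq_root_count field_simps)
qed

end
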